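(* Let $\mathcal{A}$ be a finite collection of arithmetic progressions $a_i + d_i\mathbb{Z}$ with moduli $d_i > 1$, such that the moduli $d_i$ are pairwise distinct and each $d_i$ is square-free, and such that $\bigcup_i (a_i + d_i\mathbb{Z}) = \mathbb{Z}$. Then at least one of the moduli $d_i$ is even. *)

theory Defs
  imports "HOL-Computational_Algebra.Squarefree" "HOL-Number_Theory.Cong"
begin

end

theory Submission
  imports Defs Complex_Main
begin

text \<open>
  The proof uses the distortion method of Balister, Bollobas, Morris, Sahasrabudhe and Tiba. A progression
  with square-free modulus \<open>d\<close> prescribes the residues modulo the primes dividing \<open>d\<close>, so by the Chinese
  remainder theorem it suffices to find a choice of residues that avoids all these prescriptions.

  A probability measure on the choices is built one odd prime \<open>p\<close> at a time. The progressions whose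
  largest prime is \<open>p\<close> cover some residues in each fibre over the earlier choices; the mass of the fibre
  is moved away from them as far as possible while no residue receives more than a fraction \<open>1 / (p - t)\<close>
  of it. Hence prescribing the residues at the primes of a set \<open>U\<close> is an event of probability at most the
  product of the factors \<open>1 / (p - t)\<close>, and the newly covered mass is at most the mean of
  \<open>max 0 (N - t) / (p - t)\<close>, where \<open>N\<close> counts the progressions with largest prime \<open>p\<close> that the earlier
  choices still allow. Moments of \<open>N\<close>, truncated to progressions with few prime factors, bound this mean
  in terms of the sums of those probability bounds over all sets \<open>U\<close> of a given size.

  These sums, and with them the total covered mass, are computed in rounded integer arithmetic up to
  \<open>2 ^ 15\<close>. Beyond that, bounding the number of primes in a dyadic interval by the central binomial
  coefficient gives a convergent geometric series. The total stays below \<open>1\<close>.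
\<close>

section \<open>The distortion step\<close>

text \<open>A positive normalised linear functional plays the part of a probability measure. Those
  constructed below are finite combinations of point evaluations, so every real function has a mean
  and no sigma-algebra is involved.\<close>

locale expectation =
  fixes E :: "((nat \<Rightarrow> nat) \<Rightarrow> real) \<Rightarrow> real"
  assumes add: "E (\<lambda>x. f x + h x) = E f + E h"
    and scale: "E (\<lambda>x. b * f x) = b * E f"
    and mono: "(\<And>x. f x \<le> h x) \<Longrightarrow> E f \<le> E h"
    and one: "E (\<lambda>_. 1) = 1"
begin

lemma zero: "E (\<lambda>_. 0) = 0"
  using scale[of 0 "\<lambda>_. 0"] by simp

lemma nonneg: "(\<And>x. 0 \<le> f x) \<Longrightarrow> 0 \<le> E f"
  using mono[of "\<lambda>_. 0" f] zero by simp

lemma sum: "E (\<lambda>x. \<Sum>i\<in>A. f i x) = (\<Sum>i\<in>A. E (f i))"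
proof (cases "finite A")
  case True
  then show ?thesis by (induction A) (simp_all add: zero add)
qed (simp add: zero)

end

text \<open>A point assigns a residue to every prime; reading it modulo \<open>q\<close> spares a range restriction.\<close>

definition agree :: "nat set \<Rightarrow> (nat \<Rightarrow> nat) \<Rightarrow> (nat \<Rightarrow> nat) \<Rightarrow> bool"
  where "agree U a x \<longleftrightarrow> (\<forall>q\<in>U. x q mod q = a q)"

text \<open>One bound per set \<open>U\<close>, uniform in the prescribed residues \<open>a\<close>:
  the moment estimates know which primes occur in a progression but nothing about its
  residues.\<close>

definition dominated :: "(((nat \<Rightarrow> nat) \<Rightarrow> real) \<Rightarrow> real) \<Rightarrow> nat set \<Rightarrow> (nat set \<Rightarrow> real) \<Rightarrow> bool"
  where "dominated E P g \<longleftrightarrow> (\<forall>U a. U \<subseteq> P \<longrightarrow> E (\<lambda>x. of_bool (agree U a x)) \<le> g U)"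

text \<open>Distinct square-free moduli are told apart by their sets of primes, so a progression is
  a set \<open>F\<close> with residues \<open>c F\<close>. It counts only once all its primes have
  been treated.\<close>

definition covered :: "nat set set \<Rightarrow> (nat set \<Rightarrow> nat \<Rightarrow> nat) \<Rightarrow> nat set \<Rightarrow> (nat \<Rightarrow> nat) \<Rightarrow> bool"
  where "covered \<F> c P x \<longleftrightarrow> (\<exists>F\<in>\<F>. F \<subseteq> P \<and> agree F (c F) x)"

text \<open>Here \<open>F\<close> stands for the progression with primes \<open>insert p F\<close>,
  where \<open>p\<close> is the next prime. All subsets of \<open>P\<close> take part, as if every
  such progression were present.\<close>

definition hits :: "nat set \<Rightarrow> (nat set \<Rightarrow> nat \<Rightarrow> nat) \<Rightarrow> (nat \<Rightarrow> nat) \<Rightarrow> nat"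
  where "hits P a x = card {F. F \<subseteq> P \<and> agree F (a F) x}"

definition excess_le :: "(((nat \<Rightarrow> nat) \<Rightarrow> real) \<Rightarrow> real) \<Rightarrow> nat set \<Rightarrow> nat \<Rightarrow> real \<Rightarrow> bool"
  where "excess_le E P t \<beta> \<longleftrightarrow> (\<forall>a. E (\<lambda>x. max 0 (real (hits P a x) - real t)) \<le> \<beta>)"

text \<open>Starting from the constant \<open>1\<close>, repeated extension makes \<open>g U\<close>
  the product of the factors \<open>w\<close> attached to the primes in \<open>U\<close>.\<close>

definition extend :: "nat \<Rightarrow> real \<Rightarrow> (nat set \<Rightarrow> real) \<Rightarrow> nat set \<Rightarrow> real"
  where "extend p w g U = (if p \<in> U then w * g (U - {p}) else g U)"

lemma agree_upd: "p \<notin> U \<Longrightarrow> agree U a (x(p := y)) = agree U a x"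
  by (auto simp: agree_def)

text \<open>The new conditional distribution on the residues modulo \<open>p\<close>: it gives the covered residues \<open>B\<close> as
  little mass as a density bounded by \<open>1 / (p - t)\<close> allows.\<close>

definition kernel :: "nat \<Rightarrow> nat \<Rightarrow> nat set \<Rightarrow> nat \<Rightarrow> real"
  where "kernel p t B y =
    (if card B \<le> t then if y \<in> B then 0 else 1 / (real p - real (card B))
     else if y \<in> B then (real (card B) - real t) / (real (card B) * (real p - real t))
     else 1 / (real p - real t))"

text \<open>If \<open>card B \<le> t\<close>, the complement of \<open>B\<close> has at least
  \<open>p - t\<close> residues and can carry all the mass. Otherwise it is filled to density
  \<open>1 / (p - t)\<close>, and the remainder \<open>(card B - t) / (p - t)\<close> is spread
  evenly over \<open>B\<close>.\<close>

lemma
  assumes "B \<subseteq> {..<p}" "t < p"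
  shows kernel_nonneg: "0 \<le> kernel p t B y"
    and kernel_le: "kernel p t B y \<le> 1 / (real p - real t)"
    and kernel_sum: "(\<Sum>y<p. kernel p t B y) = 1"
    and kernel_sum_B: "(\<Sum>y\<in>B. kernel p t B y) = max 0 (real (card B) - real t) / (real p - real t)"
proof -
  have fin: "finite B" using assms(1) finite_subset by blast
  have cB: "card B \<le> p" using card_mono[OF _ assms(1)] by simp
  show "0 \<le> kernel p t B y" using assms(2) cB by (auto simp: kernel_def)
  show "kernel p t B y \<le> 1 / (real p - real t)"
  proof -
    have "(real (card B) - real t) / (real (card B) * (real p - real t)) \<le> 1 / (real p - real t)"
      if "\<not> card B \<le> t"
    proof -
      have "(real (card B) - real t) / real (card B) \<le> 1" using that by simp
      from divide_right_mono[OF this, of "real p - real t"] show ?thesis using assms(2) by simp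
    qed
    moreover have "1 / (real p - real (card B)) \<le> 1 / (real p - real t)" if "card B \<le> t"
      using that assms(2) by (intro divide_left_mono mult_pos_pos) auto
    ultimately show ?thesis using assms(2) by (auto simp: kernel_def)
  qed
  show B: "(\<Sum>y\<in>B. kernel p t B y) = max 0 (real (card B) - real t) / (real p - real t)"
  proof (cases "card B \<le> t")
    case True
    then have "(\<Sum>y\<in>B. kernel p t B y) = (\<Sum>y\<in>B. 0)" by (intro sum.cong) (auto simp: kernel_def)
    with True show ?thesis by simp
  next
    case False
    then have "(\<Sum>y\<in>B. kernel p t B y) =
        (\<Sum>y\<in>B. (real (card B) - real t) / (real (card B) * (real p - real t)))"
      by (intro sum.cong) (auto simp: kernel_def)
    with False show ?thesis by (simp add: max_def)
  qed
  have C: "(\<Sum>y\<in>{..<p} - B. kernel p t B y) =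
     (real p - real (card B)) * (if card B \<le> t then 1 / (real p - real (card B)) else 1 / (real p - real t))"
  proof -
    have "(\<Sum>y\<in>{..<p} - B. kernel p t B y) = (\<Sum>y\<in>{..<p} - B.
        (if card B \<le> t then 1 / (real p - real (card B)) else 1 / (real p - real t)))"
      by (intro sum.cong) (auto simp: kernel_def)
    then show ?thesis using assms(1) fin cB by (simp add: card_Diff_subset of_nat_diff)
  qed
  have "(\<Sum>y<p. kernel p t B y) = (\<Sum>y\<in>{..<p} - B. kernel p t B y) + (\<Sum>y\<in>B. kernel p t B y)"
    using assms(1) by (simp add: sum.subset_diff)
  also have "\<dots> = 1"
  proof (cases "card B \<le> t")
    case True
    then show ?thesis unfolding B C using assms(2) by simp
  next
    case False
    then show ?thesis unfolding B C using assms(2) by (simp add: add_divide_distrib[symmetric])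
  qed
  finally show "(\<Sum>y<p. kernel p t B y) = 1" .
qed

text \<open>The factor \<open>w\<close> is any upper bound for \<open>1 / (p - t)\<close>, so that
  all primes of a block can later share the factor computed at the lower end of the block.\<close>

lemma distortion_step:
  assumes E: "expectation E" and dom: "dominated E P g" and P: "finite P" "p \<notin> P" and t: "t < p"
    and exc: "excess_le E P t \<beta>" and cov: "E (\<lambda>x. of_bool (covered \<F> c P x)) \<le> \<kappa>"
    and w: "1 / (real p - real t) \<le> w"
  shows "\<exists>E'. expectation E' \<and> dominated E' (insert p P) (extend p w g) \<and>
           E' (\<lambda>x. of_bool (covered \<F> c (insert p P) x)) \<le> \<kappa> + w * \<beta>"
proof -
  interpret expectation E by (rule E)
  define v where "v = 1 / (real p - real t)"
  have v0: "0 \<le> v" using t by (simp add: v_def)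
  \<comment> \<open>A progression involving \<open>p\<close> is split into its conditions at
    \<open>P\<close> and its residue at \<open>p\<close>. \<open>B x\<close> contains every residue
    modulo \<open>p\<close> that such a progression covers in the fibre over
    \<open>x\<close>.\<close>
  define a where "a = (\<lambda>F. c (insert p F))"
  define B where "B = (\<lambda>x. {y. y < p \<and> (\<exists>F. F \<subseteq> P \<and> agree F (a F) x \<and> y = a F p)})"
  have Bp: "B x \<subseteq> {..<p}" for x by (auto simp: B_def)
  define k where "k x y = kernel p t (B x) y" for x y
  note kn = kernel_nonneg[OF Bp t, folded k_def] and kl = kernel_le[OF Bp t, folded k_def v_def]
    and ks = kernel_sum[OF Bp t, folded k_def] and kB = kernel_sum_B[OF Bp t, folded k_def]
  \<comment> \<open>First draw \<open>x\<close> from \<open>E\<close>, then redraw the coordinate at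
    \<open>p\<close> with density \<open>k x\<close>.\<close>
  define E' where "E' = (\<lambda>f. E (\<lambda>x. \<Sum>y<p. k x y * f (x(p := y))))"
  have E': "expectation E'"
  proof
    fix f h :: "(nat \<Rightarrow> nat) \<Rightarrow> real" and b :: real
    show "E' (\<lambda>x. f x + h x) = E' f + E' h"
      by (simp add: E'_def distrib_left sum.distrib add)
    show "E' (\<lambda>x. b * f x) = b * E' f"
      unfolding E'_def scale[symmetric] by (simp add: sum_distrib_left mult.left_commute)
    show "E' f \<le> E' h" if "\<And>x. f x \<le> h x"
      unfolding E'_def by (intro mono sum_mono mult_left_mono that kn)
    show "E' (\<lambda>_. 1) = 1" by (simp add: E'_def ks one)
  qed
  have g0: "0 \<le> g U" if "U \<subseteq> P" for U
  proof -
    have "0 \<le> E (\<lambda>x. of_bool (agree U (\<lambda>_. 0) x))" by (rule nonneg) simp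
    also have "\<dots> \<le> g U" using dom that unfolding dominated_def by blast
    finally show ?thesis .
  qed
  have "dominated E' (insert p P) (extend p w g)"
    unfolding dominated_def
  proof (intro allI impI)
    fix U a assume U: "U \<subseteq> insert p P"
    show "E' (\<lambda>x. of_bool (agree U a x)) \<le> extend p w g U"
    proof (cases "p \<in> U")
      case False
      then have "E' (\<lambda>x. of_bool (agree U a x)) = E (\<lambda>x. of_bool (agree U a x))"
        by (simp only: E'_def agree_upd[OF False] ks mult_1_left flip: sum_distrib_right)
      moreover have "U \<subseteq> P" using U False by auto
      ultimately show ?thesis using dom False by (simp add: dominated_def extend_def)
    next
      case True
      let ?V = "U - {p}"
      have V: "?V \<subseteq> P" using U by auto
      \<comment> \<open>At most one \<open>y < p\<close> equals the prescribed \<open>a p\<close>,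
        and the kernel gives it at most \<open>v\<close>.\<close>
      have pt: "(\<Sum>y<p. k x y * of_bool (agree U a (x(p := y)))) \<le> v * of_bool (agree ?V a x)" for x
      proof -
        have "(of_bool (agree U a (x(p := y))) :: real) = of_bool (agree ?V a x) * of_bool (y = a p)"
          if "y < p" for y
          using True that by (auto simp: agree_def)
        then have "(\<Sum>y<p. k x y * of_bool (agree U a (x(p := y)))) =
            (\<Sum>y<p. (k x y * of_bool (y = a p)) * of_bool (agree ?V a x))"
          by (intro sum.cong refl) simp
        also have "\<dots> = (\<Sum>y<p. k x y * of_bool (y = a p)) * of_bool (agree ?V a x)"
          by (simp add: sum_distrib_right)
        also have "\<dots> \<le> v * of_bool (agree ?V a x)"
        proof (rule mult_right_mono)
          have "(\<Sum>y<p. k x y * of_bool (y = a p)) = (\<Sum>y<p. if y = a p then k x y else 0)"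
            by (intro sum.cong) auto
          also have "\<dots> \<le> v" using kl v0 by (simp add: sum.delta)
          finally show "(\<Sum>y<p. k x y * of_bool (y = a p)) \<le> v" .
        qed simp
        finally show ?thesis .
      qed
      have "E' (\<lambda>x. of_bool (agree U a x)) \<le> v * E (\<lambda>x. of_bool (agree ?V a x))"
        unfolding E'_def scale[symmetric] by (rule mono) (rule pt)
      also have "\<dots> \<le> v * g ?V" using dom V v0 by (simp add: dominated_def mult_left_mono)
      also have "\<dots> \<le> w * g ?V" by (rule mult_right_mono[OF w[folded v_def] g0[OF V]])
      finally show ?thesis using True by (simp add: extend_def)
    qed
  qed
  moreover have "E' (\<lambda>x. of_bool (covered \<F> c (insert p P) x)) \<le> \<kappa> + w * \<beta>"
  proof -
    \<comment> \<open>A covering set that avoids \<open>p\<close> does not notice the change of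
      coordinate \<open>p\<close>; one that contains \<open>p\<close> forces \<open>y\<close> into
      \<open>B x\<close>.\<close>
    have cs: "covered \<F> c P x \<or> y \<in> B x" if cv: "covered \<F> c (insert p P) (x(p := y))" and y: "y < p" for x y
    proof -
      obtain F where F: "F \<in> \<F>" "F \<subseteq> insert p P" "agree F (c F) (x(p := y))"
        using cv by (auto simp: covered_def)
      show ?thesis
      proof (cases "p \<in> F")
        case True
        have *: "a (F - {p}) = c F" using True by (simp add: a_def insert_absorb)
        have "F - {p} \<subseteq> P" "agree (F - {p}) (a (F - {p})) x" "y = a (F - {p}) p"
          using F True y unfolding * by (auto simp: agree_def split: if_splits)
        then have "y \<in> B x" using y by (auto simp: B_def)
        then show ?thesis ..
      next
        case False
        then show ?thesis using F by (auto simp: covered_def agree_upd)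
      qed
    qed
    have BN: "card (B x) \<le> hits P a x" for x
    proof -
      have fin: "finite {F. F \<subseteq> P \<and> agree F (a F) x}"
        by (rule finite_subset[of _ "Pow P"]) (auto simp: P)
      have "B x \<subseteq> (\<lambda>F. a F p) ` {F. F \<subseteq> P \<and> agree F (a F) x}" by (auto simp: B_def)
      then have "card (B x) \<le> card ((\<lambda>F. a F p) ` {F. F \<subseteq> P \<and> agree F (a F) x})"
        by (intro card_mono finite_imageI fin)
      also have "\<dots> \<le> hits P a x" unfolding hits_def by (rule card_image_le[OF fin])
      finally show ?thesis .
    qed
    have pt: "(\<Sum>y<p. k x y * of_bool (covered \<F> c (insert p P) (x(p := y))))
        \<le> of_bool (covered \<F> c P x) + v * max 0 (real (hits P a x) - real t)" for x
    proof -
      have "(\<Sum>y<p. k x y * of_bool (covered \<F> c (insert p P) (x(p := y))))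
        \<le> (\<Sum>y<p. k x y * of_bool (covered \<F> c P x) + (if y \<in> B x then k x y else 0))"
      proof (rule sum_mono)
        fix y assume y: "y \<in> {..<p}"
        show "k x y * of_bool (covered \<F> c (insert p P) (x(p := y))) \<le>
            k x y * of_bool (covered \<F> c P x) + (if y \<in> B x then k x y else 0)"
          using cs[of x y] kn[of x y] y
          by (cases "covered \<F> c (insert p P) (x(p := y))"; cases "covered \<F> c P x") auto
      qed
      also have "\<dots> = of_bool (covered \<F> c P x) + (\<Sum>y\<in>B x. k x y)"
      proof -
        have "(\<Sum>y<p. if y \<in> B x then k x y else 0) = (\<Sum>y\<in>B x. k x y)"
          using Bp[of x] by (simp only: sum.inter_restrict[OF finite_lessThan, symmetric] inf_absorb2)
        moreover have "(\<Sum>y<p. k x y * of_bool (covered \<F> c P x)) = of_bool (covered \<F> c P x)"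
          by (simp only: ks mult_1_left flip: sum_distrib_right)
        ultimately show ?thesis by (simp only: sum.distrib)
      qed
      also have "\<dots> \<le> of_bool (covered \<F> c P x) + v * max 0 (real (hits P a x) - real t)"
      proof (rule add_left_mono)
        have "(\<Sum>y\<in>B x. k x y) = v * max 0 (real (card (B x)) - real t)"
          by (simp add: kB v_def)
        also have "\<dots> \<le> v * max 0 (real (hits P a x) - real t)"
          using BN[of x] v0 by (intro mult_left_mono) auto
        finally show "(\<Sum>y\<in>B x. k x y) \<le> v * max 0 (real (hits P a x) - real t)" .
      qed
      finally show ?thesis .
    qed
    have "E' (\<lambda>x. of_bool (covered \<F> c (insert p P) x)) \<le>
       E (\<lambda>x. of_bool (covered \<F> c P x) + v * max 0 (real (hits P a x) - real t))"
      unfolding E'_def by (rule mono) (rule pt)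
    also have "\<dots> \<le> \<kappa> + v * \<beta>"
      using cov exc v0 by (simp add: add scale excess_le_def add_mono mult_left_mono)
    also have "\<dots> \<le> \<kappa> + w * \<beta>"
    proof -
      have "0 \<le> E (\<lambda>x. max 0 (real (hits P a x) - real t))" by (rule nonneg) simp
      then have "0 \<le> \<beta>" using exc unfolding excess_le_def by (meson order_trans)
      then show ?thesis using mult_right_mono[OF w[folded v_def]] by simp
    qed
    finally show ?thesis .
  qed
  ultimately show ?thesis using E' by blast
qed

section \<open>Bounding the excess\<close>

lemma dominated_nonneg:
  assumes "expectation E" "dominated E P g" "U \<subseteq> P"
  shows "0 \<le> g U"
proof -
  have "0 \<le> E (\<lambda>x. of_bool (agree U (\<lambda>_. 0) x))"
    using assms(1) by (rule expectation.nonneg) simp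
  also have "\<dots> \<le> g U" using assms unfolding dominated_def by blast
  finally show ?thesis .
qed

text \<open>If \<open>g U\<close> is a product of factors \<open>w\<close> over \<open>U\<close>,
  then taking for \<phi> the indicator of size \<open>j\<close> gives the elementary symmetric sum
  of degree \<open>j\<close>, and taking \<open>7 ^ u\<close> gives the product of all
  \<open>1 + 7 * w\<close>.\<close>

definition weight :: "(nat set \<Rightarrow> real) \<Rightarrow> nat set \<Rightarrow> (nat \<Rightarrow> real) \<Rightarrow> real"
  where "weight g P \<phi> = (\<Sum>U\<in>Pow P. \<phi> (card U) * g U)"

lemma sum_Pow_insert:
  assumes "finite P" "p \<notin> P"
  shows "(\<Sum>U\<in>Pow (insert p P). f U) = (\<Sum>U\<in>Pow P. f U + f (insert p U))"
proof -
  have "Pow P \<inter> insert p ` Pow P = {}" using assms(2) by auto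
  moreover have "inj_on (insert p) (Pow P)" using assms(2) by (auto simp: inj_on_def)
  ultimately show ?thesis
    using assms(1) by (simp add: Pow_insert sum.union_disjoint sum.reindex sum.distrib)
qed

text \<open>Sorting the subsets by whether they contain \<open>p\<close> yields the usual recursion
  for elementary symmetric sums.\<close>

lemma weight_extend:
  assumes "finite P" "p \<notin> P"
  shows "weight (extend p w g) (insert p P) \<phi> = weight g P \<phi> + w * weight g P (\<lambda>v. \<phi> (Suc v))"
proof -
  have "\<phi> (card U) * extend p w g U + \<phi> (card (insert p U)) * extend p w g (insert p U)
      = \<phi> (card U) * g U + w * (\<phi> (Suc (card U)) * g U)" if "U \<in> Pow P" for U
  proof -
    have "p \<notin> U" "finite U" using that assms finite_subset by auto
    then show ?thesis by (simp add: extend_def)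
  qed
  then show ?thesis
    by (simp add: weight_def sum_Pow_insert[OF assms] sum.distrib sum_distrib_left)
qed

lemma weight_add: "weight g P (\<lambda>v. \<phi> v + \<psi> v) = weight g P \<phi> + weight g P \<psi>"
  by (simp add: weight_def distrib_right sum.distrib)

lemma weight_scale: "weight g P (\<lambda>v. b * \<phi> v) = b * weight g P \<phi>"
  by (simp add: weight_def sum_distrib_left mult.assoc)

lemma weight_sum: "weight g P (\<lambda>v. \<Sum>i\<in>A. \<phi> i v) = (\<Sum>i\<in>A. weight g P (\<phi> i))"
  by (simp add: weight_def sum_distrib_right sum.swap[of _ A])

text \<open>Discrete convexity: the increments of \<open>n choose Suc r\<close> are
  \<open>n choose r\<close>, which grow with \<open>n\<close>, so the line through \<open>m\<close>
  with slope \<open>m choose r\<close> stays below on both sides of \<open>m\<close>.\<close>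

lemma binomial_tangent:
  fixes m n r :: nat
  shows "real (m choose Suc r) + real (m choose r) * (real n - real m) \<le> real (n choose Suc r)"
proof (cases "m \<le> n")
  case True
  then show ?thesis
  proof (induction n rule: dec_induct)
    case (step n)
    have "real (m choose r) \<le> real (n choose r)"
      using step.hyps by (simp add: binomial_right_mono)
    with step.IH show ?case by (simp add: algebra_simps)
  qed simp
next
  case False
  then have "n \<le> m" by simp
  then show ?thesis
  proof (induction n rule: inc_induct)
    case (step n)
    have "real (n choose r) \<le> real (m choose r)"
      using step.hyps by (simp add: binomial_right_mono)
    with step.IH show ?case by (simp add: algebra_simps)
  qed simp
qed

text \<open>The line of \<open>binomial_tangent\<close> has its zero at
  \<open>r * (m + 1) / (r + 1)\<close>, and the hypothesis says, free of subtraction, that this zero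
  is at most \<open>s\<close>. Hence the parallel line through \<open>s\<close> lies below
  it.\<close>

lemma excess_le_binomial:
  fixes m n r s :: nat
  assumes "Suc r * m + Suc r \<le> Suc r * s + m + 1"
  shows "(real n - real s) * real (m choose r) \<le> real (n choose Suc r)"
proof -
  have *: "real (Suc r) * real (m choose Suc r) = (real m - real r) * real (m choose r)"
  proof (cases "r \<le> m")
    case True
    have "Suc r * (m choose Suc r) = (m - r) * (m choose r)"
      using binomial_absorb_comp[of m r] by (metis Suc_times_binomial_eq binomial_absorption mult.commute)
    then show ?thesis using True by (metis of_nat_diff of_nat_mult)
  qed (simp add: binomial_eq_0)
  have "(real n - real s) * real (Suc r) \<le> real m - real r + real (Suc r) * (real n - real m)"
    using assms by (simp add: algebra_simps flip: of_nat_mult of_nat_add of_nat_Suc) 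
  then have "(real n - real s) * real (Suc r) * real (m choose r)
      \<le> (real m - real r + real (Suc r) * (real n - real m)) * real (m choose r)"
    by (rule mult_right_mono) simp
  also have "\<dots> = real (Suc r) * (real (m choose Suc r) + real (m choose r) * (real n - real m))"
    by (simp only: distrib_left *) (simp add: algebra_simps)
  also have "\<dots> \<le> real (Suc r) * real (n choose Suc r)"
    by (intro mult_left_mono binomial_tangent) simp
  finally show ?thesis by (simp add: mult.commute[of _ "real (Suc r)"] mult.left_commute del: of_nat_Suc)
qed

text \<open>The line \<open>n - t\<close> touches the cubic at \<open>n = 3 * t / 2\<close>, so the
  constant is the best possible; the difference of the two sides has a double root there.\<close>

lemma excess_le_cube:
  fixes n t :: real
  assumes "0 \<le> n" "0 < t"
  shows "n - t \<le> 4 / (27 * t\<^sup>2) * n ^ 3"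
proof -
  have "0 \<le> (2 * n - 3 * t)\<^sup>2 * (n + 3 * t)" using assms by simp
  also have "\<dots> = 4 * n ^ 3 - 27 * t\<^sup>2 * (n - t)"
    by (simp add: power2_eq_square power3_eq_cube algebra_simps)
  finally show ?thesis using assms by (simp add: field_simps)
qed

section \<open>Counting families of small sets by their union\<close>

definition small_subsets :: "nat \<Rightarrow> nat set \<Rightarrow> nat set set"
  where "small_subsets k P = {F. F \<subseteq> P \<and> F \<noteq> {} \<and> card F \<le> k}"

definition small_count :: "nat \<Rightarrow> nat \<Rightarrow> nat"
  where "small_count k v = (\<Sum>j=1..k. v choose j)"

lemma finite_small_subsets [simp]: "finite P \<Longrightarrow> finite (small_subsets k P)"
  by (rule finite_subset[of _ "Pow P"]) (auto simp: small_subsets_def)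

lemma card_small_subsets:
  assumes "finite P"
  shows "card (small_subsets k P) = small_count k (card P)"
proof -
  have "small_subsets k P = (\<Union>j\<in>{1..k}. {F. F \<subseteq> P \<and> card F = j})"
    using assms by (auto simp: small_subsets_def Suc_le_eq card_gt_0_iff dest: finite_subset)
  also have "card \<dots> = (\<Sum>j=1..k. card {F. F \<subseteq> P \<and> card F = j})"
    using assms by (intro card_UN_disjoint) auto
  finally show ?thesis using assms by (simp add: small_count_def n_subsets)
qed

text \<open>Binomial inversion makes \<open>cs ! v\<close> the number of \<open>r\<close>-element families of sets of size \<open>1..k\<close>
  whose union is a given set of size \<open>v\<close>; see \<open>card_families_Union\<close>.\<close>

definition union_counts :: "nat \<Rightarrow> nat \<Rightarrow> nat list \<Rightarrow> bool"
  where "union_counts k r cs \<longleftrightarrow> length cs = Suc (k * r) \<and>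
    (\<forall>v<length cs. (\<Sum>j\<le>v. (v choose j) * cs ! j) = small_count k v choose r)"

definition families :: "nat \<Rightarrow> nat \<Rightarrow> nat set \<Rightarrow> nat set set set"
  where "families k r P = {S. S \<subseteq> small_subsets k P \<and> card S = r}"

lemma finite_families [simp]: "finite P \<Longrightarrow> finite (families k r P)"
  by (rule finite_subset[of _ "Pow (small_subsets k P)"]) (auto simp: families_def)

lemma card_Union_families:
  assumes "S \<in> families k r P" "finite P"
  shows "card (\<Union>S) \<le> k * r"
proof -
  have fin: "finite S" using assms finite_subset[OF _ finite_small_subsets] by (auto simp: families_def)
  have "card (\<Union>S) \<le> (\<Sum>F\<in>S. card F)" by (rule card_Union_le_sum_card)
  also have "\<dots> \<le> (\<Sum>F\<in>S. k)" using assms by (intro sum_mono) (auto simp: families_def small_subsets_def)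
  finally show ?thesis using assms by (simp add: families_def mult.commute)
qed

text \<open>Sorting all families of small subsets of \<open>V\<close> by their union writes the
  total as a sum over \<open>U \<subseteq> V\<close>. By induction the terms with
  \<open>U \<noteq> V\<close> agree with the table, and the defining equation of
  \<open>union_counts\<close> then forces the last one.\<close>

lemma card_families_Union:
  assumes "union_counts k r cs" "finite V" "card V < length cs"
  shows "card {S \<in> families k r V. \<Union>S = V} = cs ! card V"
  using assms(2,3)
proof (induction "card V" arbitrary: V rule: less_induct)
  case less
  let ?n = "\<lambda>U. card {S \<in> families k r U. \<Union>S = U}"
  have fam: "{S \<in> families k r V. \<Union>S = U} = {S \<in> families k r U. \<Union>S = U}" if "U \<subseteq> V" for U
    using that by (auto simp: families_def small_subsets_def)
  have "families k r V = (\<Union>U\<in>Pow V. {S \<in> families k r V. \<Union>S = U})"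
    by (auto simp: families_def small_subsets_def)
  then have "card (families k r V) = card (\<Union>U\<in>Pow V. {S \<in> families k r V. \<Union>S = U})"
    by simp
  also have "\<dots> = (\<Sum>U\<in>Pow V. card {S \<in> families k r V. \<Union>S = U})"
    using less.prems(1) by (intro card_UN_disjoint) auto
  also have "\<dots> = (\<Sum>U\<in>Pow V. ?n U)" using fam by (intro sum.cong) auto
  also have "\<dots> = ?n V + (\<Sum>U\<in>Pow V - {V}. ?n U)"
    using less.prems(1) by (subst sum.remove[of _ V]) auto
  also have "(\<Sum>U\<in>Pow V - {V}. ?n U) = (\<Sum>U\<in>Pow V - {V}. cs ! card U)"
  proof (rule sum.cong)
    fix U assume "U \<in> Pow V - {V}"
    then have "U \<subset> V" by auto
    with less.prems have "card U < card V" "finite U" by (auto simp: psubset_card_mono finite_subset)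
    with less show "?n U = cs ! card U" by simp
  qed simp
  finally have "card (families k r V) = ?n V + (\<Sum>U\<in>Pow V - {V}. cs ! card U)" .
  moreover have "(\<Sum>U\<in>Pow V. cs ! card U) = cs ! card V + (\<Sum>U\<in>Pow V - {V}. cs ! card U)"
    using less.prems(1) by (intro sum.remove) auto
  ultimately have "card (families k r V) + cs ! card V = ?n V + (\<Sum>U\<in>Pow V. cs ! card U)"
    by linarith
  moreover have "card (families k r V) = small_count k (card V) choose r"
    using less.prems(1) by (simp add: families_def n_subsets card_small_subsets)
  moreover have "(\<Sum>U\<in>Pow V. cs ! card U) = (\<Sum>j\<le>card V. (card V choose j) * cs ! j)"
  proof -
    have "(\<Sum>U\<in>Pow V. cs ! card U) = (\<Sum>j\<le>card V. \<Sum>U\<in>{U \<in> Pow V. card U = j}. cs ! card U)"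
      using less.prems(1) by (intro sum.group[symmetric]) (auto intro: card_mono)
    also have "\<dots> = (\<Sum>j\<le>card V. (card V choose j) * cs ! j)"
      using less.prems(1) by (intro sum.cong refl) (simp add: n_subsets)
    finally show ?thesis .
  qed
  ultimately show ?case using assms(1) less.prems(2) by (simp add: union_counts_def)
qed

text \<open>All families with union \<open>U\<close> contribute the same \<open>g U\<close>, and
  their number depends on \<open>card U\<close> alone. A union has at most \<open>k * r\<close>
  elements, so the table covers every size that occurs.\<close>

lemma sum_families:
  assumes "union_counts k r cs" "finite P"
  shows "(\<Sum>S\<in>families k r P. g (\<Union>S)) = (\<Sum>v<length cs. real (cs ! v) * weight g P (\<lambda>u. of_bool (u = v)))"
proof -
  have "(\<Sum>S\<in>families k r P. g (\<Union>S)) = (\<Sum>U\<in>Pow P. \<Sum>S\<in>{S \<in> families k r P. \<Union>S = U}. g (\<Union>S))"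
    using assms(2) by (intro sum.group[symmetric]) (auto simp: families_def small_subsets_def)
  also have "\<dots> = (\<Sum>U\<in>Pow P. real (card {S \<in> families k r P. \<Union>S = U}) * g U)"
    by (intro sum.cong refl) simp
  also have "\<dots> = (\<Sum>U\<in>Pow P. (\<Sum>v<length cs. of_bool (card U = v) * real (cs ! v)) * g U)"
  proof (intro sum.cong refl arg_cong2[where f = "(*)"])
    fix U assume "U \<in> Pow P"
    then have U: "U \<subseteq> P" "finite U" using assms(2) finite_subset by auto
    then have *: "{S \<in> families k r P. \<Union>S = U} = {S \<in> families k r U. \<Union>S = U}"
      by (auto simp: families_def small_subsets_def)
    show "real (card {S \<in> families k r P. \<Union>S = U}) = (\<Sum>v<length cs. of_bool (card U = v) * real (cs ! v))"
    proof (cases "card U < length cs")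
      case True
      have "(\<Sum>v<length cs. of_bool (card U = v) * real (cs ! v)) =
          (\<Sum>v<length cs. if card U = v then real (cs ! v) else 0)"
        by (intro sum.cong) auto
      with True card_families_Union[OF assms(1) U(2)] show ?thesis by (simp add: * sum.delta')
    next
      case False
      then have "{S \<in> families k r U. \<Union>S = U} = {}"
        using card_Union_families[OF _ U(2), of _ k r] assms(1) by (fastforce simp: union_counts_def)
      moreover have "(\<Sum>v<length cs. of_bool (card U = v) * real (cs ! v)) = 0"
        using False by (intro sum.neutral) auto
      ultimately show ?thesis by (simp only: * card.empty of_nat_0)
    qed
  qed
  also have "\<dots> = weight g P (\<lambda>u. \<Sum>v<length cs. real (cs ! v) * of_bool (u = v))"
    by (simp add: weight_def mult.commute)
  also have "\<dots> = (\<Sum>v<length cs. real (cs ! v) * weight g P (\<lambda>u. of_bool (u = v)))"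
    by (simp only: weight_sum weight_scale)
  finally show ?thesis .
qed


lemma (in expectation) agree_all_le:
  assumes "dominated E P g" "finite S" "\<Union>S \<subseteq> P"
  shows "E (\<lambda>x. of_bool (\<forall>F\<in>S. agree F (a F) x)) \<le> g (\<Union>S)"
proof -
  \<comment> \<open>At \<open>q\<close> the residue is taken from some member of \<open>S\<close>
    containing \<open>q\<close>. If members conflict at \<open>q\<close>, no \<open>x\<close> agrees
    with all of them, so the choice is harmless.\<close>
  define b where "b q = a (SOME F. F \<in> S \<and> q \<in> F) q" for q
  have "agree (\<Union>S) b x" if "\<forall>F\<in>S. agree F (a F) x" for x
    unfolding agree_def
  proof
    fix q assume "q \<in> \<Union>S"
    then have "\<exists>F. F \<in> S \<and> q \<in> F" by blast
    from someI_ex[OF this] that show "x q mod q = b q" unfolding agree_def b_def by blast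
  qed
  then have "E (\<lambda>x. of_bool (\<forall>F\<in>S. agree F (a F) x)) \<le> E (\<lambda>x. of_bool (agree (\<Union>S) b x))"
    by (intro mono) auto
  also have "\<dots> \<le> g (\<Union>S)" using assms unfolding dominated_def by blast
  finally show ?thesis .
qed

text \<open>Sets with more than \<open>k\<close> elements are dropped at the cost of their first moment; the others are
  treated by a binomial moment. The empty set, which stands for the progression of modulus \<open>p\<close>, can
  contribute to every point, whence the shift from \<open>s\<close> to \<open>Suc s\<close>.\<close>

lemma excess_truncated:
  assumes E: "expectation E" "dominated E P g" "finite P"
    and cs: "union_counts k (Suc r) cs"
    and m: "Suc r * m + Suc r \<le> Suc r * s + m + 1" "r \<le> m"
  shows "excess_le E P (Suc s) ((\<Sum>v<length cs. real (cs ! v) * weight g P (\<lambda>u. of_bool (u = v))) / real (m choose r)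
           + weight g P (\<lambda>u. of_bool (k < u)))"
  unfolding excess_le_def
proof
  fix a
  interpret expectation E by fact
  let ?A = "\<lambda>x. {F \<in> small_subsets k P. agree F (a F) x}"
  let ?D = "{F \<in> Pow P. k < card F}"
  have fD: "finite ?D" using E(3) by simp
  have fA: "finite (?A x)" for x using E(3) by simp
  have mpos: "0 < real (m choose r)" using m(2) by simp
  have pt: "max 0 (real (hits P a x) - real (Suc s)) \<le>
      1 / real (m choose r) * (\<Sum>S\<in>families k (Suc r) P. of_bool (\<forall>F\<in>S. agree F (a F) x))
      + (\<Sum>F\<in>?D. of_bool (agree F (a F) x))" for x
  proof -
    have fs: "finite (families k (Suc r) P)" using E(3) by simp
    have "{F. F \<subseteq> P \<and> agree F (a F) x} \<subseteq> insert {} (?A x) \<union> {F \<in> ?D. agree F (a F) x}"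
      by (auto simp: small_subsets_def)
    then have "hits P a x \<le> card (insert {} (?A x) \<union> {F \<in> ?D. agree F (a F) x})"
      unfolding hits_def using fA[of x] fD by (intro card_mono finite_UnI) (simp_all del: mem_Collect_eq)
    also have "\<dots> \<le> card (insert {} (?A x)) + card {F \<in> ?D. agree F (a F) x}"
      by (rule card_Un_le)
    also have "\<dots> \<le> Suc (card (?A x)) + card {F \<in> ?D. agree F (a F) x}"
      using card_insert_le_m1 fA by (simp add: card_insert_if)
    finally have h: "real (hits P a x) \<le> 1 + real (card (?A x)) + real (card {F \<in> ?D. agree F (a F) x})"
      by linarith
    have D: "(\<Sum>F\<in>?D. of_bool (agree F (a F) x)) = real (card {F \<in> ?D. agree F (a F) x})"
      using fD by (simp add: Int_def)
    \<comment> \<open>The families whose members all agree with \<open>x\<close> are exactly the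
      subsets of \<open>?A x\<close> of size \<open>Suc r\<close>, which turns the sum into a
      binomial coefficient.\<close>
    have "{S \<in> families k (Suc r) P. \<forall>F\<in>S. agree F (a F) x} = {S. S \<subseteq> ?A x \<and> card S = Suc r}"
      by (auto simp: families_def)
    then have S: "(\<Sum>S\<in>families k (Suc r) P. of_bool (\<forall>F\<in>S. agree F (a F) x)) = real (card (?A x) choose Suc r)"
      using fs n_subsets[OF fA, of x "Suc r"] by (simp add: Int_def)
    have "real (card (?A x)) - real s \<le> real (card (?A x) choose Suc r) / real (m choose r)"
      using excess_le_binomial[OF m(1), of "card (?A x)"] mpos by (simp add: pos_le_divide_eq)
    moreover have "0 \<le> real (card (?A x) choose Suc r) / real (m choose r)" by simp
    ultimately show ?thesis unfolding D S using h by auto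
  qed
  have "E (\<lambda>x. max 0 (real (hits P a x) - real (Suc s))) \<le>
     1 / real (m choose r) * (\<Sum>S\<in>families k (Suc r) P. E (\<lambda>x. of_bool (\<forall>F\<in>S. agree F (a F) x)))
      + (\<Sum>F\<in>?D. E (\<lambda>x. of_bool (agree F (a F) x)))"
    unfolding sum[symmetric] scale[symmetric] add[symmetric] by (rule mono) (rule pt)
  also have "\<dots> \<le> 1 / real (m choose r) * (\<Sum>S\<in>families k (Suc r) P. g (\<Union>S)) + (\<Sum>F\<in>?D. g F)"
  proof (intro add_mono mult_left_mono sum_mono)
    fix S assume S: "S \<in> families k (Suc r) P"
    then have "finite S" using E(3) finite_subset[OF _ finite_small_subsets] by (auto simp: families_def)
    then show "E (\<lambda>x. of_bool (\<forall>F\<in>S. agree F (a F) x)) \<le> g (\<Union>S)"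
      using S by (intro agree_all_le[OF E(2)]) (auto simp: families_def small_subsets_def)
  next
    fix F assume "F \<in> ?D"
    then show "E (\<lambda>x. of_bool (agree F (a F) x)) \<le> g F" using E(2) unfolding dominated_def by blast
  qed simp
  also have "(\<Sum>F\<in>?D. g F) = weight g P (\<lambda>u. of_bool (k < u))"
    unfolding weight_def using E(3) by (simp add: sum.inter_filter) (auto intro!: sum.cong)
  also have "(\<Sum>S\<in>families k (Suc r) P. g (\<Union>S)) = (\<Sum>v<length cs. real (cs ! v) * weight g P (\<lambda>u. of_bool (u = v)))"
    by (rule sum_families[OF cs E(3)])
  finally show "E (\<lambda>x. max 0 (real (hits P a x) - real (Suc s))) \<le>
      (\<Sum>v<length cs. real (cs ! v) * weight g P (\<lambda>u. of_bool (u = v))) / real (m choose r)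
           + weight g P (\<lambda>u. of_bool (k < u))"
    by simp
qed

text \<open>Each element of a union of three sets lies in a nonempty selection of them, and there
  are 7 such selections; hence a set \<open>U\<close> is the union of \<open>7 ^ card U\<close>
  ordered triples.\<close>

lemma sum_triples:
  assumes "finite P"
  shows "(\<Sum>F\<in>Pow P. \<Sum>G\<in>Pow P. \<Sum>H\<in>Pow P. g (F \<union> G \<union> H)) = weight g P (\<lambda>u. 7 ^ u)"
  using assms
proof (induction P arbitrary: g)
  case (insert p P)
  define h where "h U = g (insert p U)" for U
  have "(\<Sum>F\<in>Pow (insert p P). \<Sum>G\<in>Pow (insert p P). \<Sum>H\<in>Pow (insert p P). g (F \<union> G \<union> H))
     = (\<Sum>F\<in>Pow P. \<Sum>G\<in>Pow P. \<Sum>H\<in>Pow P. g (F \<union> G \<union> H) + 7 * h (F \<union> G \<union> H))"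
    by (simp add: sum_Pow_insert insert.hyps h_def sum.distrib flip: sum_distrib_left)
  also have "\<dots> = weight g P (\<lambda>u. 7 ^ u) + 7 * weight h P (\<lambda>u. 7 ^ u)"
    by (simp add: sum.distrib insert.IH flip: sum_distrib_left)
  also have "\<dots> = (\<Sum>U\<in>Pow P. 7 ^ card U * g U + 7 ^ card (insert p U) * g (insert p U))"
  proof -
    have "7 * (7 ^ card U * h U) = 7 ^ card (insert p U) * g (insert p U)" if "U \<in> Pow P" for U
    proof -
      have "p \<notin> U" "finite U" using that insert.hyps finite_subset by auto
      then show ?thesis by (simp add: h_def)
    qed
    then show ?thesis by (simp add: weight_def sum.distrib sum_distrib_left)
  qed
  also have "\<dots> = weight g (insert p P) (\<lambda>u. 7 ^ u)"
    by (simp add: weight_def sum_Pow_insert insert.hyps)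
  finally show ?case .
qed (simp add: weight_def)

text \<open>The cube of \<open>hits\<close> is a sum over triples of sets, and the event belonging
  to a triple is bounded by \<open>g\<close> at its union. No truncation occurs here, and one number
  suffices to carry the bound along.\<close>

lemma excess_cubic:
  assumes E: "expectation E" "dominated E P g" "finite P" and t: "0 < t"
  shows "excess_le E P t (4 / (27 * (real t)\<^sup>2) * weight g P (\<lambda>u. 7 ^ u))"
  unfolding excess_le_def
proof
  fix a
  interpret expectation E by fact
  let ?I = "\<lambda>F x. of_bool (agree F (a F) x) :: real"
  have "real (hits P a x) = (\<Sum>F\<in>Pow P. ?I F x)" for x
    using E(3) by (simp add: hits_def Int_def)
  then have "real (hits P a x) ^ 3 = (\<Sum>F\<in>Pow P. \<Sum>G\<in>Pow P. \<Sum>H\<in>Pow P. ?I F x * ?I G x * ?I H x)" for x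
    by (simp only: power3_eq_cube flip: sum_distrib_left sum_distrib_right)
  moreover have "max 0 (real (hits P a x) - real t) \<le> 4 / (27 * (real t)\<^sup>2) * real (hits P a x) ^ 3" for x
    using excess_le_cube[of "real (hits P a x)" "real t"] t by simp
  ultimately have "E (\<lambda>x. max 0 (real (hits P a x) - real t)) \<le>
     4 / (27 * (real t)\<^sup>2) * (\<Sum>F\<in>Pow P. \<Sum>G\<in>Pow P. \<Sum>H\<in>Pow P. E (\<lambda>x. ?I F x * ?I G x * ?I H x))"
    unfolding sum[symmetric] scale[symmetric] by (intro mono) simp
  also have "\<dots> \<le> 4 / (27 * (real t)\<^sup>2) * (\<Sum>F\<in>Pow P. \<Sum>G\<in>Pow P. \<Sum>H\<in>Pow P. g (F \<union> G \<union> H))"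
  proof (intro mult_left_mono sum_mono)
    fix F G H assume *: "F \<in> Pow P" "G \<in> Pow P" "H \<in> Pow P"
    have "E (\<lambda>x. ?I F x * ?I G x * ?I H x) = E (\<lambda>x. of_bool (\<forall>K\<in>{F, G, H}. agree K (a K) x))"
      by (intro arg_cong[of _ _ E] ext) simp
    also have "\<dots> \<le> g (\<Union>{F, G, H})" using * by (intro agree_all_le[OF E(2)]) auto
    finally show "E (\<lambda>x. ?I F x * ?I G x * ?I H x) \<le> g (F \<union> G \<union> H)" by (simp add: Un_assoc)
  qed simp
  also have "(\<Sum>F\<in>Pow P. \<Sum>G\<in>Pow P. \<Sum>H\<in>Pow P. g (F \<union> G \<union> H)) = weight g P (\<lambda>u. 7 ^ u)"
    by (rule sum_triples[OF E(3)])
  finally show "E (\<lambda>x. max 0 (real (hits P a x) - real t)) \<le> 4 / (27 * (real t)\<^sup>2) * weight g P (\<lambda>u. 7 ^ u)" .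
qed

section \<open>Profiles\<close>

text \<open>The state of the induction over the primes. \<open>E\<close> and \<open>g\<close> stay
  hidden behind the existential quantifier, so the rest of the argument manipulates numbers
  only.\<close>

definition profile :: "nat set set \<Rightarrow> (nat set \<Rightarrow> nat \<Rightarrow> nat) \<Rightarrow> nat set \<Rightarrow> nat \<Rightarrow>
    real \<Rightarrow> (nat \<Rightarrow> real) \<Rightarrow> real \<Rightarrow> real \<Rightarrow> bool"
  where "profile \<F> c P L \<kappa> e H T \<longleftrightarrow> finite P \<and> (\<exists>E g. expectation E \<and> dominated E P g \<and>
    E (\<lambda>x. of_bool (covered \<F> c P x)) \<le> \<kappa> \<and>
    (\<forall>j<L. weight g P (\<lambda>u. of_bool (u = j)) \<le> e j) \<and>
    weight g P (\<lambda>u. of_bool (L \<le> u)) \<le> H \<and> weight g P (\<lambda>u. 7 ^ u) \<le> T)"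

lemma profile_mono:
  assumes "profile \<F> c P L \<kappa> e H T" "\<kappa> \<le> \<kappa>'" "\<And>j. j < L \<Longrightarrow> e j \<le> e' j" "H \<le> H'" "T \<le> T'"
  shows "profile \<F> c P L \<kappa>' e' H' T'"
proof -
  obtain E g where "finite P" "expectation E" "dominated E P g" "E (\<lambda>x. of_bool (covered \<F> c P x)) \<le> \<kappa>"
    "\<And>j. j < L \<Longrightarrow> weight g P (\<lambda>u. of_bool (u = j)) \<le> e j"
    "weight g P (\<lambda>u. of_bool (L \<le> u)) \<le> H" "weight g P (\<lambda>u. 7 ^ u) \<le> T"
    using assms(1) unfolding profile_def by blast
  with assms(2-) show ?thesis
    unfolding profile_def by (intro conjI exI[of _ E] exI[of _ g]) (auto intro: order_trans)
qed

text \<open>The two ways of bounding the excess, by a truncated binomial moment or by the cubic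
  moment, expressed through the numbers of a profile.\<close>

definition excess_bound :: "nat \<Rightarrow> (nat \<Rightarrow> real) \<Rightarrow> real \<Rightarrow> real \<Rightarrow> nat \<Rightarrow> real \<Rightarrow> bool"
  where "excess_bound L e H T t \<beta> \<longleftrightarrow>
    (\<exists>k r m s cs. t = Suc s \<and> union_counts k (Suc r) cs \<and> length cs \<le> L \<and> k < L \<and> r \<le> m \<and>
       Suc r * m + Suc r \<le> Suc r * s + m + 1 \<and>
       (\<Sum>v<length cs. real (cs ! v) * e v) / real (m choose r) + (\<Sum>j\<in>{k<..<L}. e j) + H \<le> \<beta>) \<or>
    0 < t \<and> 4 / (27 * (real t)\<^sup>2) * T \<le> \<beta>"

lemma excess_bound_sound:
  assumes E: "expectation E" "dominated E P g" "finite P"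
    and e: "\<And>j. j < L \<Longrightarrow> weight g P (\<lambda>u. of_bool (u = j)) \<le> e j"
    and H: "weight g P (\<lambda>u. of_bool (L \<le> u)) \<le> H" and T: "weight g P (\<lambda>u. 7 ^ u) \<le> T"
    and b: "excess_bound L e H T t \<beta>"
  shows "excess_le E P t \<beta>"
proof -
  have mono: "excess_le E P t \<beta>" if "excess_le E P t \<beta>'" "\<beta>' \<le> \<beta>" for \<beta>'
    using that unfolding excess_le_def by (meson order_trans)
  from b consider (trunc) k r m s cs where "t = Suc s" "union_counts k (Suc r) cs" "length cs \<le> L"
       "k < L" "r \<le> m" "Suc r * m + Suc r \<le> Suc r * s + m + 1"
       "(\<Sum>v<length cs. real (cs ! v) * e v) / real (m choose r) + (\<Sum>j\<in>{k<..<L}. e j) + H \<le> \<beta>"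
    | (cubic) "0 < t" "4 / (27 * (real t)\<^sup>2) * T \<le> \<beta>"
    unfolding excess_bound_def by blast
  then show ?thesis
  proof cases
    case trunc
    have "weight g P (\<lambda>u. of_bool (k < u)) =
        weight g P (\<lambda>u. (\<Sum>j\<in>{k<..<L}. of_bool (u = j)) + of_bool (L \<le> u))"
      using trunc(4) by (intro arg_cong[of _ _ "weight g P"] ext) auto
    also have "\<dots> \<le> (\<Sum>j\<in>{k<..<L}. e j) + H"
      unfolding weight_add weight_sum using e H by (intro add_mono sum_mono) auto
    finally have "weight g P (\<lambda>u. of_bool (k < u)) \<le> (\<Sum>j\<in>{k<..<L}. e j) + H" .
    moreover have "(\<Sum>v<length cs. real (cs ! v) * weight g P (\<lambda>u. of_bool (u = v))) / real (m choose r)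
        \<le> (\<Sum>v<length cs. real (cs ! v) * e v) / real (m choose r)"
      using e trunc(3) by (intro divide_right_mono sum_mono mult_left_mono) auto
    ultimately show ?thesis
      using mono[OF excess_truncated[OF E trunc(2,6,5), folded trunc(1)]] trunc(7) by linarith
  next
    case cubic
    have "4 / (27 * (real t)\<^sup>2) * weight g P (\<lambda>u. 7 ^ u) \<le> 4 / (27 * (real t)\<^sup>2) * T"
      using T by (intro mult_left_mono) auto
    with cubic show ?thesis using mono[OF excess_cubic[OF E cubic(1)]] by linarith
  qed
qed

lemma profile_step:
  assumes prof: "profile \<F> c P L \<kappa> e H T" and p: "p \<notin> P" "x \<le> p" "t < x" and L: "0 < L"
    and b: "excess_bound L e H T t \<beta>" and w: "w = 1 / (real x - real t)"
  shows "profile \<F> c (insert p P) L (\<kappa> + w * \<beta>) (\<lambda>j. e j + w * (if j = 0 then 0 else e (j - 1)))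
           (H + w * (H + e (L - 1))) (T + 7 * w * T)"
proof -
  obtain E g where E: "finite P" "expectation E" "dominated E P g" "E (\<lambda>x. of_bool (covered \<F> c P x)) \<le> \<kappa>"
    "\<And>j. j < L \<Longrightarrow> weight g P (\<lambda>u. of_bool (u = j)) \<le> e j"
    "weight g P (\<lambda>u. of_bool (L \<le> u)) \<le> H" "weight g P (\<lambda>u. 7 ^ u) \<le> T"
    using prof unfolding profile_def by blast
  have w': "1 / (real p - real t) \<le> w" "0 \<le> w" using p w by (auto simp: frac_le)
  have exc: "excess_le E P t \<beta>" by (rule excess_bound_sound[OF E(2,3,1,5,6,7) b])
  obtain E' where E': "expectation E'" "dominated E' (insert p P) (extend p w g)"
     "E' (\<lambda>x. of_bool (covered \<F> c (insert p P) x)) \<le> \<kappa> + w * \<beta>"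
    using distortion_step[OF E(2,3,1) p(1) _ exc E(4) w'(1)] p by auto
  let ?g = "extend p w g"
  have "weight ?g (insert p P) (\<lambda>u. of_bool (u = j)) \<le> e j + w * (if j = 0 then 0 else e (j - 1))"
    if "j < L" for j
  proof (cases j)
    case 0
    then show ?thesis using E(5)[of j] that by (simp add: weight_extend[OF E(1) p(1)]) (simp add: weight_def)
  next
    case (Suc i)
    then show ?thesis using E(5)[of j] E(5)[of i] that w'(2)
      by (simp add: weight_extend[OF E(1) p(1)] add_mono mult_left_mono)
  qed
  moreover have "weight ?g (insert p P) (\<lambda>u. of_bool (L \<le> u)) \<le> H + w * (H + e (L - 1))"
  proof -
    \<comment> \<open>Adding \<open>p\<close> moves the sets with exactly \<open>L - 1\<close>
      elements into the tail, whence the term \<open>e (L - 1)\<close>.\<close>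
    have "weight g P (\<lambda>u. of_bool (L \<le> Suc u)) = weight g P (\<lambda>u. of_bool (L \<le> u) + of_bool (u = L - 1))"
      using L by (intro arg_cong[of _ _ "weight g P"] ext) auto
    also have "\<dots> \<le> H + e (L - 1)" unfolding weight_add using E(5)[of "L - 1"] E(6) L by simp
    finally show ?thesis using E(6) w'(2)
      by (simp add: weight_extend[OF E(1) p(1)] add_mono mult_left_mono)
  qed
  moreover have "weight ?g (insert p P) (\<lambda>u. 7 ^ u) \<le> T + 7 * w * T"
  proof -
    have "weight ?g (insert p P) (\<lambda>u. 7 ^ u) = (1 + 7 * w) * weight g P (\<lambda>u. 7 ^ u)"
      by (simp add: weight_extend[OF E(1) p(1)] weight_scale algebra_simps)
    also have "\<dots> \<le> (1 + 7 * w) * T" using E(7) w'(2) by (intro mult_left_mono) auto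
    finally show ?thesis by (simp add: algebra_simps)
  qed
  ultimately show ?thesis using E' E(1) unfolding profile_def by blast
qed

text \<open>The bounds \<open>e'\<close>, \<open>H'\<close>, \<open>T'\<close> hold before every single step of the block, so that all steps can use
  the same charge and the growth is linear in the number of steps.\<close>

lemma profile_block:
  assumes prof: "profile \<F> c P L \<kappa> e H T" and L: "0 < L" and t: "t < x" and w: "w = 1 / (real x - real t)"
    and b: "excess_bound L e' H' T' t \<beta>"
    and e': "\<And>j. j < L \<Longrightarrow> e j + real (n - 1) * w * (if j = 0 then 0 else e' (j - 1)) \<le> e' j"
    and H': "H + real (n - 1) * w * (H' + e' (L - 1)) \<le> H'"
    and T': "T + real (n - 1) * (7 * w * T') \<le> T'"
    and nonneg: "\<And>j. j < L \<Longrightarrow> 0 \<le> e' j" "0 \<le> H'" "0 \<le> T'" "0 \<le> \<beta>"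
    and A: "finite A" "A \<inter> P = {}" "\<And>p. p \<in> A \<Longrightarrow> x \<le> p" "card A \<le> n"
  shows "profile \<F> c (P \<union> A) L (\<kappa> + real n * (w * \<beta>))
     (\<lambda>j. e j + real n * w * (if j = 0 then 0 else e' (j - 1)))
     (H + real n * w * (H' + e' (L - 1))) (T + real n * (7 * w * T'))"
proof -
  have w0: "0 \<le> w" using w t by simp
  let ?d = "\<lambda>j. w * (if j = 0 then 0 else e' (j - 1))"
  have d0: "0 \<le> ?d j" if "j < L" for j using w0 nonneg(1) that by auto
  have e0: "0 \<le> e' (L - 1)" using nonneg(1) L by simp
  have *: "profile \<F> c (P \<union> A) L (\<kappa> + real (card A) * (w * \<beta>)) (\<lambda>j. e j + real (card A) * ?d j)
     (H + real (card A) * (w * (H' + e' (L - 1)))) (T + real (card A) * (7 * w * T'))"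
    using A
  proof (induction A)
    case empty
    then show ?case using prof by simp
  next
    case (insert p A)
    let ?i = "real (card A)"
    \<comment> \<open>Before the step at \<open>p\<close> at most \<open>n - 1\<close> primes of the
      block have been treated, so the hypotheses with \<open>n - 1\<close> bound the current state
      by \<open>e'\<close>, \<open>H'\<close> and \<open>T'\<close>.\<close>
    have i: "?i \<le> real (n - 1)" "card A \<le> n" using insert by auto
    let ?e = "\<lambda>j. e j + ?i * ?d j" and ?H = "H + ?i * (w * (H' + e' (L - 1)))" and ?T = "T + ?i * (7 * w * T')"
    have IH: "profile \<F> c (P \<union> A) L (\<kappa> + ?i * (w * \<beta>)) ?e ?H ?T"
      using insert.IH insert.prems i by auto
    have le: "?e j \<le> e' j" if "j < L" for j
      using mult_right_mono[OF i(1) d0[OF that]] e'[OF that] by (simp add: mult.assoc)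
    have leH: "?H \<le> H'"
      using mult_right_mono[OF i(1), of "w * (H' + e' (L - 1))"] H' w0 nonneg(2) e0 by (simp add: mult.assoc)
    have leT: "?T \<le> T'"
      using mult_right_mono[OF i(1), of "7 * w * T'"] T' w0 nonneg(3) by simp
    have "excess_bound L ?e ?H ?T t \<beta>"
    proof -
      have *: "(\<Sum>v<length cs. real (cs ! v) * ?e v) / real (m choose r) + (\<Sum>j\<in>{k<..<L}. ?e j) + ?H \<le>
         (\<Sum>v<length cs. real (cs ! v) * e' v) / real (m choose r) + (\<Sum>j\<in>{k<..<L}. e' j) + H'"
        if "length cs \<le> L" for cs :: "nat list" and m r k
        using that by (intro add_mono divide_right_mono sum_mono mult_left_mono le leH) auto
      have **: "4 / (27 * (real t)\<^sup>2) * ?T \<le> 4 / (27 * (real t)\<^sup>2) * T'"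
        using leT by (intro mult_left_mono) auto
      show ?thesis using b order_trans[OF *] order_trans[OF **] unfolding excess_bound_def by blast
    qed
    from profile_step[OF IH _ _ t L this w, of p] insert
    have "profile \<F> c (insert p (P \<union> A)) L (\<kappa> + ?i * (w * \<beta>) + w * \<beta>)
       (\<lambda>j. ?e j + w * (if j = 0 then 0 else ?e (j - 1))) (?H + w * (?H + ?e (L - 1))) (?T + 7 * w * ?T)"
      by auto
    then show ?case
      unfolding Un_insert_right
    proof (rule profile_mono)
      have card: "real (card (insert p A)) = ?i + 1" using insert.hyps by simp
      show "\<kappa> + ?i * (w * \<beta>) + w * \<beta> \<le> \<kappa> + real (card (insert p A)) * (w * \<beta>)"
        using insert.hyps by (simp add: algebra_simps)
      show "?e j + w * (if j = 0 then 0 else ?e (j - 1)) \<le> e j + real (card (insert p A)) * ?d j" if "j < L" for j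
      proof (cases "j = 0")
        case False
        have "w * ?e (j - 1) \<le> w * e' (j - 1)" using le[of "j - 1"] that w0 by (intro mult_left_mono) auto
        then show ?thesis unfolding card by (simp only: False if_False distrib_right mult_1_left)
      qed simp
      show "?H + w * (?H + ?e (L - 1)) \<le> H + real (card (insert p A)) * (w * (H' + e' (L - 1)))"
        using mult_left_mono[OF add_mono[OF leH le[of "L - 1"]] w0] L insert.hyps by (simp add: algebra_simps)
      show "?T + 7 * w * ?T \<le> T + real (card (insert p A)) * (7 * w * T')"
        using mult_left_mono[OF leT w0] insert.hyps by (simp add: algebra_simps)
    qed
  qed
  show ?thesis
  proof (rule profile_mono[OF *])
    have n: "real (card A) \<le> real n" using A by simp
    show "\<kappa> + real (card A) * (w * \<beta>) \<le> \<kappa> + real n * (w * \<beta>)"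
      using mult_right_mono[OF n, of "w * \<beta>"] w0 nonneg(4) by simp
    show "e j + real (card A) * ?d j \<le> e j + real n * w * (if j = 0 then 0 else e' (j - 1))" if "j < L" for j
      using mult_right_mono[OF n d0[OF that]] by (simp add: mult.assoc)
    show "H + real (card A) * (w * (H' + e' (L - 1))) \<le> H + real n * w * (H' + e' (L - 1))"
      using mult_right_mono[OF n, of "w * (H' + e' (L - 1))"] w0 nonneg(2) e0 by (simp add: mult.assoc)
    show "T + real (card A) * (7 * w * T') \<le> T + real n * (7 * w * T')"
      using mult_right_mono[OF n, of "7 * w * T'"] w0 nonneg(3) by simp
  qed
qed


section \<open>Profiles reduced to the data of the cubic moment\<close>

definition cubic_profile :: "nat set set \<Rightarrow> (nat set \<Rightarrow> nat \<Rightarrow> nat) \<Rightarrow> nat set \<Rightarrow> real \<Rightarrow> real \<Rightarrow> bool"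
  where "cubic_profile \<F> c P \<kappa> T \<longleftrightarrow> finite P \<and> (\<exists>E g. expectation E \<and> dominated E P g \<and>
    E (\<lambda>x. of_bool (covered \<F> c P x)) \<le> \<kappa> \<and> weight g P (\<lambda>u. 7 ^ u) \<le> T)"

lemma profile_cubic: "profile \<F> c P L \<kappa> e H T \<Longrightarrow> cubic_profile \<F> c P \<kappa> T"
  unfolding profile_def cubic_profile_def by blast

lemma cubic_profile_mono:
  "cubic_profile \<F> c P \<kappa> T \<Longrightarrow> \<kappa> \<le> \<kappa>' \<Longrightarrow> T \<le> T' \<Longrightarrow> cubic_profile \<F> c P \<kappa>' T'"
  unfolding cubic_profile_def by (meson order_trans)

lemma cubic_step:
  assumes "cubic_profile \<F> c P \<kappa> T" "p \<notin> P" "x \<le> p" "0 < t" "t < x"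
  shows "cubic_profile \<F> c (insert p P) (\<kappa> + 4 * T / (27 * (real t)\<^sup>2 * (real x - real t)))
           (T * (1 + 7 / (real x - real t)))"
proof -
  obtain E g where E: "finite P" "expectation E" "dominated E P g" "E (\<lambda>x. of_bool (covered \<F> c P x)) \<le> \<kappa>"
    "weight g P (\<lambda>u. 7 ^ u) \<le> T"
    using assms(1) unfolding cubic_profile_def by blast
  \<comment> \<open>A profile with a single tracked size, bounded by its own weights, so that
    \<open>profile_step\<close> applies with the cubic alternative.\<close>
  have "profile \<F> c P 1 \<kappa> (\<lambda>_. weight g P (\<lambda>u. of_bool (u = 0))) (weight g P (\<lambda>u. of_bool (1 \<le> u))) T"
    unfolding profile_def using E by (intro conjI exI[of _ E] exI[of _ g]) auto
  moreover have "excess_bound 1 (\<lambda>_. weight g P (\<lambda>u. of_bool (u = 0))) (weight g P (\<lambda>u. of_bool (1 \<le> u))) T t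
      (4 / (27 * (real t)\<^sup>2) * T)"
    unfolding excess_bound_def using assms(4) by blast
  ultimately have "cubic_profile \<F> c (insert p P) (\<kappa> + 1 / (real x - real t) * (4 / (27 * (real t)\<^sup>2) * T))
      (T + 7 * (1 / (real x - real t)) * T)"
    by (rule profile_cubic[OF profile_step[OF _ assms(2,3,5) zero_less_one _ refl]])
  then show ?thesis by (rule cubic_profile_mono) (simp_all add: field_simps)
qed

lemma cubic_profile_nonneg:
  assumes "cubic_profile \<F> c P \<kappa> T"
  shows "0 \<le> T"
proof -
  obtain E g where E: "expectation E" "dominated E P g" "weight g P (\<lambda>u. 7 ^ u) \<le> T"
    using assms unfolding cubic_profile_def by blast
  have "0 \<le> weight g P (\<lambda>u. 7 ^ u)"
    unfolding weight_def using dominated_nonneg[OF E(1,2)] by (intro sum_nonneg) auto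
  with E(3) show ?thesis by linarith
qed

lemma cubic_block:
  assumes prof: "cubic_profile \<F> c P \<kappa> T" and t: "0 < t" "t < x"
    and T': "T * (1 + 7 / (real x - real t)) ^ n \<le> T'"
    and A: "finite A" "A \<inter> P = {}" "\<And>p. p \<in> A \<Longrightarrow> x \<le> p" "card A \<le> n"
  shows "cubic_profile \<F> c (P \<union> A) (\<kappa> + real n * (4 * T' / (27 * (real t)\<^sup>2 * (real x - real t)))) T'"
proof -
  let ?u = "1 + 7 / (real x - real t)" and ?b = "27 * (real t)\<^sup>2 * (real x - real t)"
  have u: "1 \<le> ?u" and b: "0 < ?b" using t by simp_all
  have T0: "0 \<le> T" using prof by (rule cubic_profile_nonneg)
  have pow: "T * ?u ^ i \<le> T'" if "i \<le> n" for i
    using mult_left_mono[OF power_increasing[OF that u] T0] T' by linarith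
  have T'0: "0 \<le> T'" using pow[of 0] T0 by simp
  have *: "cubic_profile \<F> c (P \<union> A) (\<kappa> + real (card A) * (4 * T' / ?b)) (T * ?u ^ card A)"
    using A
  proof (induction A)
    case empty
    then show ?case using prof by simp
  next
    case (insert p A)
    then have i: "card A \<le> n" by simp
    from insert i have "cubic_profile \<F> c (P \<union> A) (\<kappa> + real (card A) * (4 * T' / ?b)) (T * ?u ^ card A)"
      by auto
    from cubic_step[OF this, of p x t] insert t
    have "cubic_profile \<F> c (insert p (P \<union> A)) (\<kappa> + real (card A) * (4 * T' / ?b) + 4 * (T * ?u ^ card A) / ?b)
       (T * ?u ^ card A * ?u)" by auto
    then show ?case
      unfolding Un_insert_right
    proof (rule cubic_profile_mono)
      have "4 * (T * ?u ^ card A) / ?b \<le> 4 * T' / ?b"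
        using pow[OF i] b by (intro divide_right_mono) auto
      show "\<kappa> + real (card A) * (4 * T' / ?b) + 4 * (T * ?u ^ card A) / ?b
          \<le> \<kappa> + real (card (insert p A)) * (4 * T' / ?b)"
      proof -
        have "real (card (insert p A)) * (4 * T' / ?b) = real (card A) * (4 * T' / ?b) + 4 * T' / ?b"
          using insert.hyps by (simp add: distrib_right add_divide_distrib)
        with \<open>4 * (T * ?u ^ card A) / ?b \<le> 4 * T' / ?b\<close> show ?thesis by linarith
      qed
      show "T * ?u ^ card A * ?u \<le> T * ?u ^ card (insert p A)" using insert.hyps by (simp add: mult.commute mult.left_commute)
    qed
  qed
  show ?thesis
  proof (rule cubic_profile_mono[OF *])
    show "\<kappa> + real (card A) * (4 * T' / ?b) \<le> \<kappa> + real n * (4 * T' / ?b)"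
      using A T'0 b by (intro add_left_mono mult_right_mono) auto
    show "T * ?u ^ card A \<le> T'" using pow A by simp
  qed
qed

text \<open>Bernoulli gives \<open>1 - n * u \<le> (1 - u) ^ n\<close>, and
  \<open>(1 + u) * (1 - u) \<le> 1\<close>. The bound is a rational expression without powers,
  suited to integer arithmetic.\<close>

lemma power_le_inverse:
  fixes u :: real
  assumes "0 \<le> u" "real n * u < 1"
  shows "(1 + u) ^ n \<le> 1 / (1 - real n * u)"
proof (cases "n = 0")
  case False
  then have u1: "u \<le> 1" using assms mult_right_mono[of 1 "real n" u] by simp
  have "(1 + u) ^ n * (1 - real n * u) \<le> (1 + u) ^ n * (1 - u) ^ n"
    using Bernoulli_inequality[of "- u" n] u1 assms by (intro mult_left_mono) auto
  also have "\<dots> = (1 - u\<^sup>2) ^ n"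
    by (simp add: power_mult_distrib[symmetric] algebra_simps power2_eq_square)
  also have "\<dots> \<le> 1" using u1 assms(1) by (intro power_le_one) (auto simp: abs_square_le_1 power_le_one)
  finally show ?thesis using assms by (simp add: pos_le_divide_eq)
qed simp

section \<open>Large primes\<close>

definition odd_primes_below :: "nat \<Rightarrow> nat set"
  where "odd_primes_below m = {p. prime p \<and> 2 < p \<and> p < m}"

section \<open>Primes in dyadic intervals\<close>

lemma prod_primes_dvd_nat:
  fixes n :: nat
  assumes "finite S" "\<And>p. p \<in> S \<Longrightarrow> prime p \<and> p dvd n"
  shows "\<Prod>S dvd n"
  using assms
proof (induction S)
  case (insert p S)
  have "coprime p (\<Prod>S)"
    using insert by (intro prod_coprime_right) (metis insertCI primes_coprime)
  with insert show ?case by (simp add: divides_mult)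
qed simp

text \<open>With \<open>n = 2 ^ k\<close>, the primes between \<open>n\<close> and
  \<open>2 * n\<close> divide the central binomial coefficient, so their product is at most
  \<open>2 ^ (2 * n)\<close>. Each of them exceeds \<open>2 ^ k\<close>; comparing exponents gives
  the claim.\<close>

lemma dyadic_prime_count:
  "card {p. prime p \<and> 2 ^ k < p \<and> p < (2::nat) ^ Suc k} * k \<le> 2 ^ Suc k"
proof -
  define n where "n = (2::nat) ^ k"
  define S where "S = {p. prime p \<and> n < p \<and> p < 2 * n}"
  have fin: "finite S" by (rule finite_subset[of _ "{..<2 * n}"]) (auto simp: S_def)
  have "\<Prod>S dvd (2 * n choose n)"
  proof (rule prod_primes_dvd_nat[OF fin])
    fix p assume p: "p \<in> S"
    then have "p dvd fact (2 * n)" by (auto simp: S_def prime_dvd_fact_iff)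
    moreover have "fact (2 * n) = fact n * fact n * (2 * n choose n)"
      using binomial_fact_lemma[of n "2 * n"] by (simp add: mult_2)
    moreover have "\<not> p dvd fact n" using p by (auto simp: S_def prime_dvd_fact_iff)
    ultimately show "prime p \<and> p dvd (2 * n choose n)"
      using p by (auto simp: S_def prime_dvd_mult_iff)
  qed
  then have "\<Prod>S \<le> (2 * n choose n)" by (rule dvd_imp_le) simp
  also have "\<dots> \<le> 2 ^ (2 * n)"
  proof -
    have "(2 * n choose n) \<le> (\<Sum>i\<le>2 * n. 2 * n choose i)" by (rule member_le_sum) auto
    then show ?thesis by (simp add: choose_row_sum)
  qed
  finally have "\<Prod>S \<le> 2 ^ (2 * n)" .
  moreover have "n ^ card S \<le> \<Prod>S"
    using prod_mono[of S "\<lambda>_. n" "\<lambda>p. p"] by (auto simp: S_def)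
  ultimately have "2 ^ (k * card S) \<le> (2::nat) ^ (2 * n)" by (simp add: n_def power_mult)
  then have "k * card S \<le> 2 * n" by (rule power_le_imp_le_exp[rotated]) simp
  then show ?thesis by (simp add: S_def n_def mult.commute)
qed

text \<open>Needed for the growth over one dyadic interval; what counts is that the bound is below
  4. The quadratic estimate of the exponential is accurate enough only near 0, hence the 64th
  root.\<close>

lemma exp_56_45: "exp (56 / 45) \<le> (71 / 20 :: real)"
proof -
  have "exp (56 / 45 :: real) = exp (7 / 360) ^ 64" by (simp flip: exp_of_nat_mult)
  also have "exp (7 / 360 :: real) ^ 64 \<le> (10199 / 10000) ^ 64"
  proof (rule power_mono)
    have "exp (7 / 360 :: real) \<le> 1 + 7 / 360 + (7 / 360)\<^sup>2" by (rule exp_bound) auto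
    also have "\<dots> \<le> 10199 / 10000" by (simp add: power2_eq_square)
    finally show "exp (7 / 360 :: real) \<le> 10199 / 10000" .
  qed simp
  also have "\<dots> = (((10199 / 10000) ^ 8) ^ 8 :: real)" by (simp only: power_mult[symmetric]) simp
  also have "\<dots> \<le> (11708 / 10000) ^ 8"
    by (rule power_mono) (simp_all add: power_divide)
  also have "\<dots> \<le> 71 / 20" by (simp add: power_divide)
  finally show ?thesis .
qed

text \<open>With threshold \<open>t = 2 ^ k div 4\<close> each prime costs a multiple of
  \<open>T / t ^ 3\<close>, and the interval has at most \<open>8 * t / 15\<close> primes. The total
  cost is of order \<open>T / 4 ^ k\<close>, while \<open>T\<close> grows by a constant
  factor.\<close>

lemma dyadic_block:
  assumes prof: "cubic_profile \<F> c (odd_primes_below m) \<kappa> T" and k: "15 \<le> k" and m: "2 ^ k \<le> m"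
  shows "cubic_profile \<F> c (odd_primes_below (max m (2 ^ Suc k)))
           (\<kappa> + 512 / 1215 * (71 / 20 * T) / 4 ^ k) (71 / 20 * T)"
proof -
  \<comment> \<open>Primes below \<open>m\<close> are already treated; \<open>m\<close> may lie
    inside the dyadic interval or beyond it, in which case \<open>A\<close> is empty.\<close>
  define A where "A = {p. prime p \<and> m \<le> p \<and> p < 2 ^ Suc k}"
  define n where "n = card {p. prime p \<and> 2 ^ k < p \<and> p < (2::nat) ^ Suc k}"
  have "n * 15 \<le> n * k" using k by simp
  also have "\<dots> \<le> 2 ^ Suc k" using dyadic_prime_count[of k] by (simp add: n_def)
  finally have n: "real n * 15 \<le> 2 * 2 ^ k"
    by (metis of_nat_le_iff of_nat_mult of_nat_numeral of_nat_power power_Suc)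
  have npow: "\<not> prime ((2::nat) ^ k)" using k by (simp add: prime_power_iff)
  have k2: "(4::nat) dvd 2 ^ k" using k le_imp_power_dvd[of 2 k "2::nat"] by simp
  define t where "t = (2::nat) ^ k div 4"
  have t: "2 ^ k = 4 * t" using k2 by (simp add: t_def)
  have t0: "0 < t" using t by (metis mult_0_right power_not_zero zero_neq_numeral gr0I)
  have T0: "0 \<le> T" using prof by (rule cubic_profile_nonneg)
  have t': "real (4 * t) - real t = 3 * real t" by simp
  have rt: "(2::real) ^ k = 4 * real t" using t by (metis of_nat_mult of_nat_numeral of_nat_power)
  have "(1 + 7 / (3 * real t)) ^ n \<le> exp (7 / (3 * real t)) ^ n"
    by (intro power_mono exp_ge_add_one_self) auto
  also have "\<dots> = exp (real n * (7 / (3 * real t)))" by (simp only: exp_of_nat_mult)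
  \<comment> \<open>The exponent is at most \<open>8 / 15 * 7 / 3\<close>.\<close>
  also have "\<dots> \<le> exp (56 / 45)"
    using n t0 rt by (simp add: field_simps)
  also have "\<dots> \<le> 71 / 20" by (rule exp_56_45)
  finally have growth: "(1 + 7 / (3 * real t)) ^ n \<le> 71 / 20" .
  have A: "finite A" "A \<inter> odd_primes_below m = {}" "\<And>p. p \<in> A \<Longrightarrow> 4 * t \<le> p"
    using m t by (auto simp: A_def odd_primes_below_def)
  have "A \<subseteq> {p. prime p \<and> 2 ^ k < p \<and> p < 2 ^ Suc k}"
    using m npow by (auto simp: A_def order.strict_iff_order)
  then have cA: "card A \<le> n" unfolding n_def by (rule card_mono[rotated]) auto
  have "cubic_profile \<F> c (odd_primes_below m \<union> A)
      (\<kappa> + real n * (4 * (71 / 20 * T) / (27 * (real t)\<^sup>2 * (real (4 * t) - real t)))) (71 / 20 * T)"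
    by (rule cubic_block[OF prof t0 _ _ A cA])
      (use t0 t' growth mult_left_mono[OF growth T0] in \<open>simp_all add: mult.commute\<close>)
  moreover have "odd_primes_below m \<union> A = odd_primes_below (max m (2 ^ Suc k))"
  proof -
    have "(2::nat) < 2 ^ k" using k power_strict_increasing[of 1 k "2::nat"] by simp
    then show ?thesis using m by (auto simp: odd_primes_below_def A_def)
  qed
  \<comment> \<open>The factor \<open>512 / 1215\<close> is \<open>8 / 15 * 4 / 81 * 16\<close>,
    where \<open>16\<close> comes from \<open>4 ^ k = 16 * t ^ 2\<close>.\<close>
  moreover have "real n * (4 * (71 / 20 * T) / (27 * (real t)\<^sup>2 * (real (4 * t) - real t)))
     \<le> 512 / 1215 * (71 / 20 * T) / 4 ^ k"
  proof -
    have "(4::real) ^ k = (2 ^ k)\<^sup>2" by (simp add: power_mult[symmetric] mult.commute[of k] flip: power_mult) (simp add: power_mult)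
    then have "(4::real) ^ k = 16 * (real t)\<^sup>2" by (simp add: rt power2_eq_square)
    moreover have "real n * (4 * (71 / 20 * T) / (27 * (real t)\<^sup>2 * (3 * real t)))
        \<le> (8 / 15 * real t) * (4 * (71 / 20 * T) / (27 * (real t)\<^sup>2 * (3 * real t)))"
      using n rt T0 by (intro mult_right_mono) auto
    moreover have "(8 / 15 * real t) * (4 * (71 / 20 * T) / (27 * (real t)\<^sup>2 * (3 * real t)))
       = 512 / 1215 * (71 / 20 * T) / (16 * (real t)\<^sup>2)"
      using t0 by (simp add: field_simps power2_eq_square)
    ultimately show ?thesis by (simp only: t')
  qed
  ultimately show ?thesis by (auto intro: cubic_profile_mono)
qed

text \<open>From one interval to the next \<open>T\<close> gains the factor \<open>71 / 20\<close>
  while the cost is divided by 4, so the costs form a geometric series of ratio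
  \<open>71 / 80\<close>.\<close>

lemma dyadic_tail:
  assumes "cubic_profile \<F> c (odd_primes_below m) \<kappa> T" "2 ^ 15 \<le> m"
  shows "cubic_profile \<F> c (odd_primes_below (max m (2 ^ (15 + i))))
     (\<kappa> + 512 / 1215 * (71 / 20) * T / 4 ^ 15 * (\<Sum>j<i. (71 / 80) ^ j)) ((71 / 20) ^ i * T)"
proof (induction i)
  case 0
  then show ?case using assms by (simp add: max_def)
next
  case (Suc i)
  have eq: "max (max m (2 ^ (15 + i))) (2 ^ Suc (15 + i)) = max m (2 ^ (15 + Suc i))"
    using power_increasing[of "15 + i" "Suc (15 + i)" "2::nat"] by (simp add: max.assoc max.absorb2)
  have "(71 / 20 * ((71 / 20) ^ i * T)) / 4 ^ (15 + i) = 71 / 20 * T / 4 ^ 15 * (71 / 80 :: real) ^ i"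
  proof -
    have "(71 / 80 :: real) ^ i = (71 / 20) ^ i / 4 ^ i" by (simp flip: power_divide)
    then show ?thesis by (simp add: power_add)
  qed
  then have "512 / 1215 * (71 / 20 * ((71 / 20) ^ i * T)) / 4 ^ (15 + i)
      = 512 / 1215 * (71 / 20) * T / 4 ^ 15 * (71 / 80 :: real) ^ i"
    by (metis (no_types, lifting) mult.assoc times_divide_eq_right)
  then have "\<kappa> + 512 / 1215 * (71 / 20) * T / 4 ^ 15 * (\<Sum>j<i. (71 / 80) ^ j)
        + 512 / 1215 * (71 / 20 * ((71 / 20) ^ i * T)) / 4 ^ (15 + i)
      = \<kappa> + 512 / 1215 * (71 / 20) * T / 4 ^ 15 * (\<Sum>j<Suc i. (71 / 80) ^ j)"
    by (simp only: sum.lessThan_Suc distrib_left add.assoc)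
  moreover have "71 / 20 * ((71 / 20) ^ i * T) = (71 / 20) ^ Suc i * T"
    by (simp only: power_Suc mult.assoc)
  ultimately show ?case using dyadic_block[OF Suc, of "15 + i"] unfolding eq by (simp only: le_add1 max.cobounded2)
qed

text \<open>The series is at most \<open>80 / 9\<close>; multiplied by the remaining constants this
  is about \<open>1.24 / 10 ^ 8\<close>, rounded up to \<open>1 / 80000000\<close>.\<close>

lemma cubic_tail:
  assumes "cubic_profile \<F> c (odd_primes_below m) \<kappa> T" "2 ^ 15 \<le> m" "\<kappa> + T / 80000000 < 1"
  shows "\<exists>\<kappa>'<1. \<exists>T'. cubic_profile \<F> c (odd_primes_below (max m (2 ^ (15 + i)))) \<kappa>' T'"
proof -
  have T0: "0 \<le> T" using assms(1) by (rule cubic_profile_nonneg)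
  have "(\<Sum>j<i. (71 / 80 :: real) ^ j) \<le> 80 / 9"
    unfolding sum_gp_strict by (simp add: field_simps)
  then have "512 / 1215 * (71 / 20) * T / 4 ^ 15 * (\<Sum>j<i. (71 / 80) ^ j)
      \<le> 512 / 1215 * (71 / 20) * T / 4 ^ 15 * (80 / 9)"
    using T0 by (intro mult_left_mono) auto
  also have "\<dots> \<le> T / 80000000" using T0 by simp
  finally show ?thesis using dyadic_tail[OF assms(1,2), of i] assms(3) by (meson add_left_mono le_less_trans)
qed

section \<open>Counting primes with a sieve of counters\<close>

text \<open>\<open>Counter k q\<close> at position \<open>x\<close> records that \<open>x + 2 k\<close> is the next odd multiple of \<open>q\<close>.
  Unary counters in a tree keep the cost of a rewriting step small.\<close>

datatype sieve = Counter nat int | Join sieve sieve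

fun tick :: "sieve \<Rightarrow> sieve" where
  "tick (Join l r) = Join (tick l) (tick r)"
| "tick (Counter 0 q) = Counter (nat (q - 1)) q"
| "tick (Counter (Suc k) q) = Counter k q"

fun struck :: "sieve \<Rightarrow> bool" where
  "struck (Join l r) \<longleftrightarrow> struck l \<or> struck r"
| "struck (Counter k q) \<longleftrightarrow> k = 0"

primrec walk :: "nat \<Rightarrow> sieve \<Rightarrow> int \<Rightarrow> int \<times> sieve" where
  "walk 0 S n = (n, S)"
| "walk (Suc L) S n = walk L (tick S) (if struck S then n else n + 1)"

fun join_pairs :: "sieve list \<Rightarrow> sieve list" where
  "join_pairs (x # y # xs) = Join x y # join_pairs xs"
| "join_pairs xs = xs"

text \<open>For odd \<open>q\<close> the number \<open>(q + 1) div 2\<close> inverts 2 modulo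
  \<open>q\<close>, so the counter starts at the solution of \<open>x + 2 * k = 0\<close> modulo
  \<open>q\<close>. Six rounds of pairing merge up to 64 counters into one tree.\<close>

definition sieve_from :: "int \<Rightarrow> int list \<Rightarrow> sieve" where
  "sieve_from x qs = hd ((join_pairs ^^ 6) (map (\<lambda>q. Counter (nat ((q - x mod q) * ((q + 1) div 2) mod q)) q) qs))"

primrec sieve_ok :: "int \<Rightarrow> sieve \<Rightarrow> bool" where
  "sieve_ok x (Join l r) \<longleftrightarrow> sieve_ok x l \<and> sieve_ok x r"
| "sieve_ok x (Counter k q) \<longleftrightarrow> 1 < q \<and> q < x \<and> q dvd x + 2 * int k"

lemma sieve_ok_tick: "sieve_ok x S \<Longrightarrow> sieve_ok (x + 2) (tick S)"
proof (induction S rule: tick.induct)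
  case (2 q)
  then have "q dvd x" "1 < q" by auto
  moreover have "x + 2 + 2 * int (nat (q - 1)) = x + 2 * q" using \<open>1 < q\<close> by simp
  ultimately show ?case using 2 by simp
next
  case (3 k q)
  then show ?case by (simp add: algebra_simps)
qed simp

lemma not_prime_struck: "sieve_ok (int p) S \<Longrightarrow> struck S \<Longrightarrow> \<not> prime p"
proof (induction S)
  case (Counter k q)
  then have q: "q dvd int p" "1 < q" "q < int p" by auto
  then have "nat q dvd p" by (metis int_dvd_int_iff int_nat_eq less_trans zero_less_one order_less_imp_le)
  with q show ?case by (auto simp: prime_nat_iff)
qed auto

text \<open>A struck position is a multiple of some \<open>q\<close> with \<open>1 < q < x\<close>,
  hence composite. So the unstruck odd positions include all primes and their number is an upper
  bound.\<close>

lemma walk_sound: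
  assumes "walk L S n = (n', S')" "sieve_ok x S" "odd x" "2 < x"
  shows "sieve_ok (x + 2 * int L) S' \<and>
    n + int (card {p. prime p \<and> x \<le> int p \<and> int p < x + 2 * int L}) \<le> n'"
  using assms
proof (induction L arbitrary: S n x)
  case (Suc L)
  let ?A = "\<lambda>x L. {p::nat. prime p \<and> x \<le> int p \<and> int p < x + 2 * int L}"
  have fin: "finite (?A x L)" for x L by (rule finite_subset[of _ "{..<nat (x + 2 * int L)}"]) auto
  from Suc.IH[of "tick S" _ "x + 2"] Suc.prems sieve_ok_tick
  have IH: "sieve_ok (x + 2 + 2 * int L) S'"
    "(if struck S then n else n + 1) + int (card (?A (x + 2) L)) \<le> n'"
    by auto
  have "?A x (Suc L) \<subseteq> ?A (x + 2) L \<union> (if struck S then {} else {nat x})"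
  proof
    fix p assume p: "p \<in> ?A x (Suc L)"
    then have "odd p" using Suc.prems(4) prime_odd_nat by auto
    then have "int p \<noteq> x + 1" using Suc.prems(3) by presburger
    then consider "int p = x" | "x + 2 \<le> int p" using p by force
    then show "p \<in> ?A (x + 2) L \<union> (if struck S then {} else {nat x})"
    proof cases
      case 1
      then show ?thesis using p not_prime_struck[of p S] Suc.prems(2) by auto
    next
      case 2
      then show ?thesis using p by auto
    qed
  qed
  then have "card (?A x (Suc L)) \<le> card (?A (x + 2) L \<union> (if struck S then {} else {nat x}))"
    using fin by (intro card_mono) auto
  also have "\<dots> \<le> card (?A (x + 2) L) + card (if struck S then {} else {nat x})"
    by (rule card_Un_le)
  finally have "int (card (?A x (Suc L))) \<le> int (card (?A (x + 2) L)) + (if struck S then 0 else 1)"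
    by (auto split: if_splits)
  with IH show ?case by (auto simp: algebra_simps split: if_splits)
next
  case 0
  have "{p::nat. prime p \<and> x \<le> int p \<and> int p < x} = {}" by auto
  then have "card {p::nat. prime p \<and> x \<le> int p \<and> int p < x} = 0" by (simp only: card.empty)
  with 0 show ?case by simp
qed

lemma sieve_from_ok:
  assumes "\<forall>q\<in>set qs. odd q \<and> 1 < q \<and> q < x" "qs \<noteq> []"
  shows "sieve_ok x (sieve_from x qs)"
proof -
  have jp: "(\<forall>S\<in>set (join_pairs Ss). sieve_ok x S) \<and> (Ss \<noteq> [] \<longrightarrow> join_pairs Ss \<noteq> [])"
    if "\<forall>S\<in>set Ss. sieve_ok x S" for Ss
    using that by (induction Ss rule: join_pairs.induct) auto
  have *: "(\<forall>S\<in>set ((join_pairs ^^ i) Ss). sieve_ok x S) \<and> (join_pairs ^^ i) Ss \<noteq> []"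
    if "\<forall>S\<in>set Ss. sieve_ok x S" "Ss \<noteq> []" for Ss i
    using that by (induction i) (auto simp: jp)
  have "sieve_ok x (Counter (nat ((q - x mod q) * ((q + 1) div 2) mod q)) q)" if "q \<in> set qs" for q
  proof -
    have q: "odd q" "1 < q" "q < x" using assms that by auto
    then have h: "2 * ((q + 1) div 2) = q + 1" by presburger
    let ?k = "(q - x mod q) * ((q + 1) div 2)"
    have "[x + 2 * (?k mod q) = x + 2 * ?k] (mod q)"
      by (intro cong_add cong_mult cong_refl) (simp add: cong_def)
    moreover have "x + 2 * ?k = x + (q - x mod q) * (q + 1)"
      by (simp only: h mult.left_commute[of 2])
    moreover have "x + (q - x mod q) * (q + 1) = q * (x div q + q - x mod q + 1)"
      by (simp add: algebra_simps)
    ultimately have "q dvd x + 2 * (?k mod q)" by (metis cong_dvd_iff dvd_triv_left)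
    then show ?thesis using q by simp
  qed
  then have "\<forall>S\<in>set (map (\<lambda>q. Counter (nat ((q - x mod q) * ((q + 1) div 2) mod q)) q) qs). sieve_ok x S"
    by simp
  from *[OF this, of 6] assms(2) show ?thesis
    unfolding sieve_from_def by (meson hd_in_set map_is_Nil_conv)
qed

section \<open>Profiles in integer arithmetic\<close>

type_synonym ledger = "int \<times> int list \<times> int \<times> int"

fun dot :: "int list \<Rightarrow> int list \<Rightarrow> int" where
  "dot (c # cs) (e # es) = c * e + dot cs es"
| "dot _ _ = 0"

text \<open>The recursion for elementary symmetric sums with factor \<open>1 / d\<close>, where
  \<open>y\<close> carries the old preceding entry and \<open>+ 1\<close> rounds up.\<close>

fun grow :: "int \<Rightarrow> int \<Rightarrow> int list \<Rightarrow> int list" where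
  "grow d y [] = []"
| "grow d y (e # es) = (e + y div d + 1) # grow d e es"

fun grow_block :: "int \<Rightarrow> int \<Rightarrow> int \<Rightarrow> int list \<Rightarrow> int list" where
  "grow_block n d y [] = []"
| "grow_block n d y (e # es) = (let e' = e + n * y div d + 1 in e' # grow_block n d e' es)"

text \<open>\<open>denom r t\<close> is \<open>m choose r\<close> for the largest \<open>m\<close> admitted by \<open>excess_le_binomial\<close> with \<open>s = t - 1\<close>.\<close>

fun denom :: "nat \<Rightarrow> int \<Rightarrow> int" where
  "denom 0 t = 1"
| "denom (Suc 0) t = 2 * t - 3"
| "denom r t = (let m = (3 * t - 5) div 2 in m * (m - 1) div 2)"

text \<open>The rounded binomial moment plus the weight of all sets with more than \<open>k\<close>
  primes; \<open>H\<close> accounts for the sizes beyond the list.\<close>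

definition charge :: "nat \<Rightarrow> nat \<Rightarrow> int list \<Rightarrow> int \<Rightarrow> int list \<Rightarrow> int \<Rightarrow> int" where
  "charge k r cs t es H = dot cs es div denom r t + 1 + sum_list (drop (Suc k) es) + H"

fun single :: "int \<times> int \<times> nat \<times> nat \<times> int list \<Rightarrow> ledger \<Rightarrow> ledger" where
  "single (p, t, k, r, cs) (\<kappa>, es, H, T) = (let d = p - t in
     (\<kappa> + charge k r cs t es H div d + 1, hd es # grow d (hd es) (tl es),
      H + (H + last es) div d + 1, T + 7 * T div d + 1))"

text \<open>Each new entry is computed from the preceding new entry, which bounds it throughout the block.\<close>

fun block :: "int \<Rightarrow> int \<Rightarrow> nat \<Rightarrow> int list \<Rightarrow> ledger \<Rightarrow> ledger option" where
  "block x n k cs (\<kappa>, es, H, T) = (let t = x div 4; d = x - t in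
     if 7 * n < d then
       let es' = hd es # grow_block n d (hd es) (tl es);
           H' = (H * d + n * last es') div (d - n) + 1
       in Some (\<kappa> + n * charge k 2 cs t es' H' div d + 1, es', H', T * d div (d - 7 * n) + 1)
     else None)"

text \<open>Matching on \<open>Some\<close>, and projections instead of a tuple pattern, keep the simplifier from unfolding
  the recursion under a binder, which takes exponential time.\<close>

fun blocks :: "nat \<Rightarrow> int \<Rightarrow> sieve \<Rightarrow> nat \<Rightarrow> int list \<Rightarrow> ledger option \<Rightarrow> (int \<times> ledger) option" where
  "blocks 0 x S k cs (Some l) = Some (x, l)"
| "blocks (Suc f) x S k cs (Some l) = (let L = x div 50; w = walk (nat L) S 0 in
     blocks f (x + 2 * L) (snd w) k cs (block x (fst w) k cs l))"
| "blocks f x S k cs None = None"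

text \<open>The quotient \<open>d / (d - 7 * n)\<close> bounds the growth
  \<open>(1 + 7 / d) ^ n\<close> by \<open>power_le_inverse\<close>.\<close>

fun cubic_block :: "int \<Rightarrow> int \<Rightarrow> int \<times> int \<Rightarrow> (int \<times> int) option" where
  "cubic_block x n (\<kappa>, T) = (let t = x div 4; d = x - t in
     if 7 * n < d then
       let T' = T * d div (d - 7 * n) + 1
       in Some (\<kappa> + n * (4 * T' div (27 * t * t) + 1) div d + 1, T')
     else None)"

fun cubic_blocks :: "nat \<Rightarrow> int \<Rightarrow> sieve \<Rightarrow> (int \<times> int) option \<Rightarrow> (int \<times> int \<times> int) option" where
  "cubic_blocks 0 x S (Some l) = Some (x, l)"
| "cubic_blocks (Suc f) x S (Some l) = (let L = x div 100; w = walk (nat L) S 0 in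
     cubic_blocks f (x + 2 * L) (snd w) (cubic_block x (fst w) l))"
| "cubic_blocks f x S None = None"

text \<open>Entries are scaled by \<open>10\<^sup>9\<close> and rounded up.\<close>

definition ledger_ok :: "nat set set \<Rightarrow> (nat set \<Rightarrow> nat \<Rightarrow> nat) \<Rightarrow> nat set \<Rightarrow> ledger \<Rightarrow> bool"
  where "ledger_ok \<F> c P l = (case l of (\<kappa>, es, H, T) \<Rightarrow>
    length es = 16 \<and> (\<forall>y\<in>set es. 0 \<le> y) \<and> 0 \<le> H \<and> 0 \<le> T \<and>
    profile \<F> c P 16 (\<kappa> / 1000000000) (\<lambda>j. real_of_int (es ! j) / 1000000000) (H / 1000000000) (T / 1000000000))"

section \<open>Rounding and the entries of the integer lists\<close>

lemma divide_le_div_plus_one: "0 < d \<Longrightarrow> real_of_int y / real_of_int d \<le> real_of_int (y div d + 1)"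
  using floor_correct[of "real_of_int y / real_of_int d"] by (simp add: floor_divide_of_int_eq)

lemma length_grow [simp]: "length (grow d y es) = length es"
  by (induction d y es rule: grow.induct) auto

lemma nth_grow: "j < length es \<Longrightarrow> grow d y es ! j = es ! j + (if j = 0 then y else es ! (j - 1)) div d + 1"
  by (induction d y es arbitrary: j rule: grow.induct) (auto simp: nth_Cons split: nat.splits)

lemma length_grow_block [simp]: "length (grow_block n d y es) = length es"
  by (induction n d y es rule: grow_block.induct) (auto simp: Let_def)

lemma nth_grow_block:
  "j < length es \<Longrightarrow> grow_block n d y es ! j =
     es ! j + n * (if j = 0 then y else grow_block n d y es ! (j - 1)) div d + 1"
proof (induction es arbitrary: j y)
  case (Cons e es)
  show ?case
  proof (cases j)
    case 0
    then show ?thesis by (simp add: Let_def)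
  next
    case (Suc i)
    then have "i < length es" using Cons.prems by simp
    from Cons.IH[OF this, of "e + n * y div d + 1"] Suc show ?thesis
      by (simp only: grow_block.simps Let_def nth_Cons_Suc diff_Suc_1 nat.simps if_False) (simp add: nth_Cons')
  qed
qed simp

lemma dot_eq: "length cs \<le> length es \<Longrightarrow> dot cs es = (\<Sum>v<length cs. cs ! v * es ! v)"
  by (induction cs es rule: dot.induct) (auto simp: sum.lessThan_Suc_shift simp del: sum.lessThan_Suc)

lemma sum_list_drop: "sum_list (drop n xs) = (\<Sum>j\<in>{n..<length xs}. xs ! j)" for xs :: "int list"
proof -
  have "sum_list (drop n xs) = (\<Sum>i = 0..<length xs - n. xs ! (i + n))"
    by (simp add: sum_list_sum_nth add.commute)
  also have "\<dots> = (\<Sum>j\<in>{n..<length xs}. xs ! j)"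
    by (rule sum.reindex_bij_witness[of _ "\<lambda>j. j - n" "\<lambda>i. i + n"]) auto
  finally show ?thesis .
qed

section \<open>Checking the tables of union counts by evaluation\<close>

primrec pascal :: "nat \<Rightarrow> int list" where
  "pascal 0 = [1]"
| "pascal (Suc n) = (let r = pascal n in map2 (+) (0 # r) (r @ [0]))"

text \<open>The moment has order \<open>Suc r\<close>; \<open>s choose 2\<close> and
  \<open>s choose 3\<close> are written as polynomials with denominators cleared, so that everything
  stays in integer arithmetic.\<close>

definition check_table :: "nat \<Rightarrow> nat \<Rightarrow> int list \<Rightarrow> bool" where
  "check_table k r cs \<longleftrightarrow> length cs = Suc (k * Suc r) \<and> list_all (\<lambda>y. 0 \<le> y) cs \<and>
     list_all (\<lambda>v. let row = pascal v; s = sum_list (take k (tl row)) in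
       if r = 0 then dot row cs = s
       else if r = 1 then 2 * dot row cs = s * (s - 1)
       else r = 2 \<and> 6 * dot row cs = s * (s - 1) * (s - 2)) [0..<length cs]"

lemma length_pascal [simp]: "length (pascal n) = Suc n"
  by (induction n) (auto simp: Let_def)

lemma nth_pascal: "j \<le> n \<Longrightarrow> pascal n ! j = int (n choose j)"
proof (induction n arbitrary: j)
  case (Suc n)
  then show ?case
    by (cases j) (auto simp: Let_def nth_append le_Suc_eq binomial_eq_0)
qed simp

lemma choose_two_int: "2 * int (n choose 2) = int n * (int n - 1)"
  by (induction n) (simp_all add: numeral_2_eq_2 algebra_simps)

lemma choose_three_int: "6 * int (n choose 3) = int n * (int n - 1) * (int n - 2)"
proof (induction n)
  case (Suc n)
  have "Suc n choose 3 = (n choose 2) + (n choose 3)" by (simp add: numeral_3_eq_3 numeral_2_eq_2)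
  then have "6 * int (Suc n choose 3) = 3 * (2 * int (n choose 2)) + 6 * int (n choose 3)" by simp
  also have "\<dots> = int (Suc n) * (int (Suc n) - 1) * (int (Suc n) - 2)"
    unfolding Suc choose_two_int by (simp add: algebra_simps)
  finally show ?case .
qed simp

lemma union_counts_table:
  assumes "check_table k r cs"
  shows "union_counts k (Suc r) (map nat cs)"
  unfolding union_counts_def
proof (intro conjI allI impI)
  show "length (map nat cs) = Suc (k * Suc r)" using assms by (simp add: check_table_def)
  fix v assume v: "v < length (map nat cs)"
  let ?s = "small_count k v"
  have nonneg: "0 \<le> cs ! j" if "j < length cs" for j
    using assms that by (simp add: check_table_def list_all_length)
  have "dot (pascal v) cs = (\<Sum>j<Suc v. pascal v ! j * cs ! j)" using v by (subst dot_eq) auto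
  also have "\<dots> = (\<Sum>j<Suc v. int ((v choose j) * map nat cs ! j))"
    using v nonneg by (intro sum.cong) (auto simp: nth_pascal)
  finally have dot: "dot (pascal v) cs = int (\<Sum>j\<le>v. (v choose j) * map nat cs ! j)"
    by (simp add: lessThan_Suc_atMost)
  have "sum_list (take k (tl (pascal v))) = (\<Sum>i<min k v. int (v choose Suc i))"
    by (simp add: sum_list_sum_nth nth_tl nth_pascal atLeast0LessThan min.commute)
  also have "\<dots> = (\<Sum>i<k. int (v choose Suc i))"
    by (intro sum.mono_neutral_left) auto
  also have "\<dots> = int ?s"
    by (simp add: small_count_def sum.atLeast1_atMost_eq)
  finally have s: "sum_list (take k (tl (pascal v))) = int ?s" .
  have chk: "if r = 0 then dot (pascal v) cs = int ?s
       else if r = 1 then 2 * dot (pascal v) cs = int ?s * (int ?s - 1)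
       else r = 2 \<and> 6 * dot (pascal v) cs = int ?s * (int ?s - 1) * (int ?s - 2)"
  proof -
    have "list_all (\<lambda>v. let row = pascal v; s = sum_list (take k (tl row)) in
       if r = 0 then dot row cs = s
       else if r = 1 then 2 * dot row cs = s * (s - 1)
       else r = 2 \<and> 6 * dot row cs = s * (s - 1) * (s - 2)) [0..<length cs]"
      using assms unfolding check_table_def by blast
    then show ?thesis unfolding Let_def list_all_iff using v by (simp only: set_upt atLeastLessThan_iff s[symmetric]) simp
  qed
  note c2 = choose_two_int[of ?s] and c3 = choose_three_int[of ?s]
  consider "r = 0" | "r = 1" | "r = 2"
  proof (rule ccontr)
    assume "\<not> thesis"
    with that have "r \<noteq> 0" "r \<noteq> 1" "r \<noteq> 2" by blast+
    with chk show False by (simp only: if_False simp_thms)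
  qed
  then have "int (\<Sum>j\<le>v. (v choose j) * map nat cs ! j) = int (?s choose Suc r)"
  proof cases
    case 1
    with chk show ?thesis unfolding dot by (simp only: if_True One_nat_def binomial_1)
  next
    case 2
    with chk have "2 * dot (pascal v) cs = int ?s * (int ?s - 1)" by (simp only: if_True if_False one_neq_zero)
    then have "dot (pascal v) cs = int (?s choose 2)" using c2 by linarith
    with 2 show ?thesis unfolding dot by (simp only: Suc_1)
  next
    case 3
    with chk have "6 * dot (pascal v) cs = int ?s * (int ?s - 1) * (int ?s - 2)" by simp
    then have "dot (pascal v) cs = int (?s choose 3)" using c3 by linarith
    with 3 show ?thesis unfolding dot by (simp only: numeral_2_eq_2 numeral_3_eq_3)
  qed
  then show "(\<Sum>j\<le>v. (v choose j) * map nat cs ! j) = ?s choose Suc r" by (simp only: of_nat_eq_iff)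
qed

text \<open>For \<open>r = 1\<close> and \<open>r = 2\<close> these are the thresholds at which the
  \<open>m\<close> behind \<open>denom\<close> is at least \<open>r\<close>, so that the denominator
  is positive.\<close>

definition mode_ok :: "nat \<Rightarrow> int \<Rightarrow> bool" where
  "mode_ok r t \<longleftrightarrow> r = 0 \<and> 1 \<le> t \<or> r = 1 \<and> 2 \<le> t \<or> r = 2 \<and> 3 \<le> t"

lemma denom_choose:
  assumes "mode_ok r t"
  shows "\<exists>m. r \<le> m \<and> Suc r * m + Suc r \<le> Suc r * (nat t - 1) + m + 1 \<and> denom r t = int (m choose r)"
proof -
  consider "r = 0" "1 \<le> t" | "r = 1" "2 \<le> t" | "r = 2" "3 \<le> t" using assms by (auto simp: mode_ok_def)
  then show ?thesis
  proof cases
    case 1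
    then show ?thesis by (intro exI[of _ 0]) simp
  next
    case 2
    then show ?thesis by (intro exI[of _ "nat (2 * t - 3)"]) auto
  next
    case 3
    define m where "m = nat ((3 * t - 5) div 2)"
    have m: "int m = (3 * t - 5) div 2" "2 \<le> m" using 3 by (auto simp: m_def)
    have "3 * m + 3 \<le> 3 * (nat t - 1) + m + 1" using 3 m by linarith
    moreover have "denom 2 t = int (m choose 2)"
      using m choose_two_int[of m] by (simp add: numeral_2_eq_2 Let_def)
    ultimately show ?thesis using 3 m by (intro exI[of _ m]) (simp add: numeral_3_eq_3 numeral_2_eq_2)
  qed
qed

lemma charge_sound:
  assumes tab: "check_table k r cs" "length cs \<le> 16" and t: "mode_ok r t" and es: "length es = 16"
  shows "excess_bound 16 (\<lambda>j. real_of_int (es ! j) / 1000000000) (H / 1000000000) T (nat t) (charge k r cs t es H / 1000000000)"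
proof -
  obtain m where m: "r \<le> m" "Suc r * m + Suc r \<le> Suc r * (nat t - 1) + m + 1" "denom r t = int (m choose r)"
    using denom_choose[OF t] by blast
  have t1: "nat t = Suc (nat t - 1)" using t by (auto simp: mode_ok_def)
  have len: "length cs = Suc (k * Suc r)" and nonneg: "\<And>v. v < length cs \<Longrightarrow> 0 \<le> cs ! v"
    using tab(1) by (auto simp: check_table_def list_all_length)
  have k: "k < 16" using len tab(2) by simp
  have "(\<Sum>v<length (map nat cs). real (map nat cs ! v) * (real_of_int (es ! v) / 1000000000)) =
      (\<Sum>v<length cs. real_of_int (cs ! v * es ! v) / 1000000000)"
    using nonneg by (intro sum.cong) auto
  also have "\<dots> = real_of_int (dot cs es) / 1000000000"
    using tab(2) es by (simp add: dot_eq sum_divide_distrib)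
  finally have 1: "(\<Sum>v<length (map nat cs). real (map nat cs ! v) * (real_of_int (es ! v) / 1000000000)) / real (m choose r)
      \<le> (dot cs es div denom r t + 1) / 1000000000"
    using divide_le_div_plus_one[of "denom r t" "dot cs es"] m by (simp add: field_simps)
  have "{k<..<16} = {Suc k..<16}" by auto
  then have 2: "(\<Sum>j\<in>{k<..<16}. real_of_int (es ! j) / 1000000000) = sum_list (drop (Suc k) es) / 1000000000"
    using es by (simp add: sum_list_drop sum_divide_distrib)
  have "charge k r cs t es H / 1000000000 =
     (dot cs es div denom r t + 1) / 1000000000 + sum_list (drop (Suc k) es) / 1000000000 + H / 1000000000"
    by (simp add: charge_def add_divide_distrib)
  with 1 2 have le: "(\<Sum>v<length (map nat cs). real (map nat cs ! v) * (real_of_int (es ! v) / 1000000000)) / real (m choose r)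
      + (\<Sum>j\<in>{k<..<16}. real_of_int (es ! j) / 1000000000) + H / 1000000000 \<le> charge k r cs t es H / 1000000000"
    by linarith
  have "length (map nat cs) \<le> 16" using tab(2) by simp
  with t1 union_counts_table[OF tab(1)] k m(1,2) le show ?thesis unfolding excess_bound_def by blast
qed

lemma charge_nonneg:
  assumes "check_table k r cs" "length cs \<le> 16" "mode_ok r t" "length es = 16" "\<forall>y\<in>set es. 0 \<le> y" "0 \<le> H"
  shows "0 \<le> charge k r cs t es H"
proof -
  obtain m where m: "r \<le> m" "denom r t = int (m choose r)" using denom_choose[OF assms(3)] by blast
  have "0 \<le> cs ! v * es ! v" if "v < length cs" for v
    using assms that by (intro mult_nonneg_nonneg) (auto simp: check_table_def list_all_length)
  then have "0 \<le> dot cs es"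
    unfolding dot_eq[OF assms(2)[folded assms(4)]] by (intro sum_nonneg) auto
  moreover have "0 < denom r t" using m by simp
  moreover have "0 \<le> sum_list (drop (Suc k) es)"
    using assms(5) in_set_dropD by (intro sum_list_nonneg) force
  ultimately show ?thesis using assms(6) by (simp add: charge_def pos_imp_zdiv_nonneg_iff)
qed

text \<open>The updates of a ledger have the shape \<open>a + y / d\<close>; this is their common
  rounding estimate.\<close>

lemma scaled_step:
  fixes a y d :: int
  assumes "0 < d"
  shows "a / 1000000000 + 1 / real_of_int d * (y / 1000000000) \<le> real_of_int (a + y div d + 1) / 1000000000"
proof -
  have "(a + real_of_int y / real_of_int d) / 1000000000 \<le> real_of_int (a + y div d + 1) / 1000000000"
    using divide_le_div_plus_one[OF assms, of y] by (intro divide_right_mono) auto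
  then show ?thesis by (simp add: add_divide_distrib)
qed

lemma single_sound:
  assumes l: "ledger_ok \<F> c P l" and p: "nat p \<notin> P" "0 < t" "t < p"
    and tab: "check_table k r cs" "length cs \<le> 16" "mode_ok r t"
  shows "ledger_ok \<F> c (insert (nat p) P) (single (p, t, k, r, cs) l)"
proof -
  obtain \<kappa> es H T where l_eq: "l = (\<kappa>, es, H, T)" by (cases l) auto
  have es: "length es = 16" "\<forall>y\<in>set es. 0 \<le> y" "0 \<le> H" "0 \<le> T"
    and prof: "profile \<F> c P 16 (\<kappa> / 1000000000) (\<lambda>j. real_of_int (es ! j) / 1000000000) (H / 1000000000) (T / 1000000000)"
    using l by (auto simp: ledger_ok_def l_eq)
  let ?d = "p - t"
  define es' where "es' = hd es # grow ?d (hd es) (tl es)"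
  have d: "0 < ?d" using p by simp
  have len: "length es' = 16" using es by (simp add: es'_def)
  have es_cons: "es = hd es # tl es" using es(1) by (cases es) auto
  have nth: "es' ! j = (if j = 0 then es ! 0 else es ! j + es ! (j - 1) div ?d + 1)" if "j < 16" for j
  proof (cases j)
    case 0
    then show ?thesis using es_cons by (metis es'_def nth_Cons_0)
  next
    case (Suc i)
    then have "i < length (tl es)" using that es(1) by simp
    then have "es' ! j = tl es ! i + (if i = 0 then hd es else tl es ! (i - 1)) div ?d + 1"
      by (simp add: es'_def Suc nth_grow)
    also have "tl es ! i = es ! j" using Suc es_cons by (metis nth_Cons_Suc)
    also have "(if i = 0 then hd es else tl es ! (i - 1)) = es ! i"
      using es_cons by (metis nth_Cons')
    finally show ?thesis using Suc by simp
  qed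
  have last: "last es = es ! 15" using es(1) by (subst last_conv_nth) auto
  have w: "1 / real_of_int ?d = 1 / (real (nat p) - real (nat t))" using p by simp
  have nn: "0 \<le> es ! j" if "j < 16" for j using es(1,2) that by simp
  have eq: "single (p, t, k, r, cs) l = (\<kappa> + charge k r cs t es H div ?d + 1, es',
      H + (H + last es) div ?d + 1, T + 7 * T div ?d + 1)"
    by (simp add: l_eq es'_def Let_def)
  have "profile \<F> c (insert (nat p) P) 16
      (real_of_int (\<kappa> + charge k r cs t es H div ?d + 1) / 1000000000) (\<lambda>j. real_of_int (es' ! j) / 1000000000)
      (real_of_int (H + (H + last es) div ?d + 1) / 1000000000) (real_of_int (T + 7 * T div ?d + 1) / 1000000000)"
  proof (rule profile_mono[OF profile_step[OF prof p(1) order_refl _ _ charge_sound[OF tab es(1)] w]])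
    show "nat t < nat p" using p by simp
    show "\<kappa> / 1000000000 + 1 / real_of_int ?d * (charge k r cs t es H / 1000000000)
        \<le> real_of_int (\<kappa> + charge k r cs t es H div ?d + 1) / 1000000000"
      by (rule scaled_step[OF d])
    show "real_of_int (es ! j) / 1000000000 + 1 / real_of_int ?d * (if j = 0 then 0 else real_of_int (es ! (j - 1)) / 1000000000)
        \<le> real_of_int (es' ! j) / 1000000000" if "j < 16" for j
    proof (cases "j = 0")
      case True
      then show ?thesis by (simp add: nth)
    next
      case False
      then show ?thesis
        using scaled_step[OF d, of "es ! j" "es ! (j - 1)"] unfolding nth[OF that] by (simp only: if_False)
    qed
    show "H / 1000000000 + 1 / real_of_int ?d * (H / 1000000000 + real_of_int (es ! (16 - 1)) / 1000000000)
        \<le> real_of_int (H + (H + last es) div ?d + 1) / 1000000000"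
      using scaled_step[OF d, of H "H + last es"] by (simp add: last add_divide_distrib)
    show "T / 1000000000 + 7 * (1 / real_of_int ?d) * (T / 1000000000)
        \<le> real_of_int (T + 7 * T div ?d + 1) / 1000000000"
      using scaled_step[OF d, of T "7 * T"] by simp
  qed simp
  moreover have "\<forall>y\<in>set es'. 0 \<le> y"
    unfolding all_set_conv_all_nth len using nn nth d by (auto simp: pos_imp_zdiv_nonneg_iff)
  moreover have "0 \<le> H + (H + last es) div ?d + 1" "0 \<le> T + 7 * T div ?d + 1"
    using es(3,4) nn[of 15] d by (auto simp: last pos_imp_zdiv_nonneg_iff)
  ultimately show ?thesis using len by (simp add: ledger_ok_def eq)
qed

lemma fold_single_sound:
  assumes "ledger_ok \<F> c P l" "distinct (map (nat \<circ> fst) xs)" "P \<inter> set (map (nat \<circ> fst) xs) = {}"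
    "\<forall>(p, t, k, r, cs)\<in>set xs. 0 < t \<and> t < p \<and> check_table k r cs \<and> length cs \<le> 16 \<and> mode_ok r t"
  shows "ledger_ok \<F> c (P \<union> set (map (nat \<circ> fst) xs)) (fold single xs l)"
  using assms
proof (induction xs arbitrary: P l)
  case (Cons y xs)
  obtain p t k r cs where y: "y = (p, t, k, r, cs)" by (cases y) auto
  have "ledger_ok \<F> c (insert (nat p) P) (single y l)"
    unfolding y using Cons.prems by (intro single_sound) (auto simp: y)
  from Cons.IH[OF this] Cons.prems show ?case by (auto simp: y)
qed simp

lemma block_sound:
  assumes l: "ledger_ok \<F> c P l" and b: "block x n k cs l = Some l'"
    and x: "20 \<le> x" "0 \<le> n" and tab: "check_table k 2 cs" "length cs \<le> 16"
    and A: "finite A" "A \<inter> P = {}" "\<And>p. p \<in> A \<Longrightarrow> nat x \<le> p" "card A \<le> nat n"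
  shows "ledger_ok \<F> c (P \<union> A) l'"
proof -
  obtain \<kappa> es H T where l_eq: "l = (\<kappa>, es, H, T)" by (cases l) auto
  have es: "length es = 16" "\<forall>y\<in>set es. 0 \<le> y" "0 \<le> H" "0 \<le> T"
    and prof: "profile \<F> c P 16 (\<kappa> / 1000000000) (\<lambda>j. real_of_int (es ! j) / 1000000000) (H / 1000000000) (T / 1000000000)"
    using l by (auto simp: ledger_ok_def l_eq)
  define t d where "t = x div 4" and "d = x - t"
  define es' where "es' = hd es # grow_block n d (hd es) (tl es)"
  define H' where "H' = (H * d + n * last es') div (d - n) + 1"
  define T' where "T' = T * d div (d - 7 * n) + 1"
  define \<beta> where "\<beta> = charge k 2 cs t es' H'"
  have nd: "7 * n < d" and l': "l' = (\<kappa> + n * \<beta> div d + 1, es', H', T')"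
    using b by (auto simp: l_eq Let_def t_def d_def es'_def H'_def T'_def \<beta>_def split: if_splits)
  have t: "5 \<le> t" "t < x" using x by (auto simp: t_def)
  have mode: "mode_ok 2 t" using t by (simp add: mode_ok_def)
  have d: "0 < d" "n < d" using nd x t by (auto simp: d_def)
  have len: "length es' = 16" using es by (simp add: es'_def)
  have es_cons: "es = hd es # tl es" using es(1) by (cases es) auto
  have nth: "es' ! j = (if j = 0 then es ! 0 else es ! j + n * es' ! (j - 1) div d + 1)" if "j < 16" for j
  proof (cases j)
    case 0
    then show ?thesis using es_cons by (metis es'_def nth_Cons_0)
  next
    case (Suc i)
    let ?r = "grow_block n d (hd es) (tl es)"
    have "i < length (tl es)" using Suc that es(1) by simp
    from nth_grow_block[OF this, of n d "hd es"]
    have "es' ! j = tl es ! i + n * (if i = 0 then hd es else ?r ! (i - 1)) div d + 1"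
      by (simp only: es'_def Suc nth_Cons_Suc)
    also have "tl es ! i = es ! j" using Suc es_cons by (metis nth_Cons_Suc)
    also have "(if i = 0 then hd es else ?r ! (i - 1)) = es' ! i"
      by (simp add: es'_def nth_Cons')
    finally show ?thesis using Suc by simp
  qed
  have nn: "0 \<le> es' ! j" if "j < 16" for j
    using that
  proof (induction j)
    case 0
    then show ?case using nth[of 0] es(1,2) by simp
  next
    case (Suc j)
    have "0 \<le> es ! Suc j" using Suc.prems es(1,2) by simp
    moreover have "0 \<le> n * es' ! j div d" using Suc x(2) d(1) by (simp add: pos_imp_zdiv_nonneg_iff)
    ultimately show ?case using nth[OF Suc.prems] by simp
  qed
  then have nns: "\<forall>y\<in>set es'. 0 \<le> y" unfolding all_set_conv_all_nth len by blast
  have last: "last es' = es' ! 15" using len by (subst last_conv_nth) (auto simp: es'_def)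
  have H'0: "0 \<le> H'"
    using es(3) nn[of 15] d x(2) by (simp add: H'_def last pos_imp_zdiv_nonneg_iff)
  have T'0: "0 \<le> T'" using es(4) nd d by (simp add: T'_def pos_imp_zdiv_nonneg_iff)
  have \<beta>0: "0 \<le> \<beta>" unfolding \<beta>_def by (rule charge_nonneg[OF tab mode len nns H'0])
  define w where "w = 1 / real_of_int d"
  have w: "w = 1 / (real (nat x) - real (nat t))" using x t by (simp add: w_def d_def)
  have w0: "0 \<le> w" using d by (simp add: w_def)
  \<comment> \<open>\<open>H'\<close> is the rounded-up solution of the corresponding equation,
    which is linear in \<open>H'\<close>; \<open>T'\<close> below arises in the same way, and
    \<open>7 * n < d\<close> keeps both divisors positive.\<close>
  have Hle: "H + n * w * (H' + es' ! 15) \<le> H'"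
  proof -
    have "(H * d + n * es' ! 15) / real_of_int (d - n) \<le> H'"
      using divide_le_div_plus_one[of "d - n" "H * d + n * es' ! 15"] d by (simp add: H'_def last)
    then have "real_of_int H * d + n * es' ! 15 \<le> H' * real_of_int (d - n)"
      using d by (simp add: pos_divide_le_eq)
    then show ?thesis using d by (simp add: w_def field_simps)
  qed
  have Tle: "T + n * (7 * w * T') \<le> T'"
  proof -
    have "T * d / real_of_int (d - 7 * n) \<le> T'"
      using divide_le_div_plus_one[of "d - 7 * n" "T * d"] nd by (simp add: T'_def)
    then have "real_of_int T * d \<le> T' * real_of_int (d - 7 * n)"
      using nd by (simp add: pos_divide_le_eq)
    then show ?thesis using d by (simp add: w_def field_simps)
  qed
  have ele: "real_of_int (es ! j) / 1000000000 + n * w * (if j = 0 then 0 else real_of_int (es' ! (j - 1)) / 1000000000)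
      \<le> real_of_int (es' ! j) / 1000000000" if "j < 16" for j
  proof (cases "j = 0")
    case True
    then show ?thesis using nth[of 0] by simp
  next
    case False
    have "real_of_int (es ! j) / 1000000000 + 1 / real_of_int d * (real_of_int (n * es' ! (j - 1)) / 1000000000)
        \<le> real_of_int (es' ! j) / 1000000000"
      using scaled_step[OF d(1), of "es ! j" "n * es' ! (j - 1)"] False unfolding nth[OF that] by simp
    then show ?thesis using False by (simp add: w_def)
  qed
  have Hle': "H / 1000000000 + n * w * (H' / 1000000000 + real_of_int (es' ! (16 - 1)) / 1000000000) \<le> H' / 1000000000"
  proof -
    have eq: "H / 1000000000 + n * w * (H' / 1000000000 + real_of_int (es' ! (16 - 1)) / 1000000000)
        = (H + n * w * (H' + es' ! 15)) / 1000000000"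
      by (simp add: add_divide_distrib distrib_left)
    show ?thesis unfolding eq using Hle by (intro divide_right_mono) simp_all
  qed
  have Tle': "T / 1000000000 + n * (7 * w * (T' / 1000000000)) \<le> T' / 1000000000"
    using divide_right_mono[OF Tle, of 1000000000] by (simp add: add_divide_distrib)
  \<comment> \<open>The estimates above allow for all \<open>n\<close> steps. They imply those with
    \<open>n - 1\<close> steps required by \<open>profile_block\<close> and also bound the state
    after the block.\<close>
  have n1: "real (nat n - 1) \<le> n" "real (nat n) = n" using x(2) by auto
  have "profile \<F> c (P \<union> A) 16 (real_of_int (\<kappa> + n * \<beta> div d + 1) / 1000000000)
      (\<lambda>j. real_of_int (es' ! j) / 1000000000) (H' / 1000000000) (T' / 1000000000)"
  proof (rule profile_mono[OF profile_block[OF prof _ _ w charge_sound[OF tab mode len, of H' "T' / 1000000000", folded \<beta>_def]]])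
    show "nat t < nat x" using t by simp
    fix j :: nat assume j: "j < 16"
    have "0 \<le> w * (if j = 0 then 0 else real_of_int (es' ! (j - 1)) / 1000000000)"
      using w0 nn[of "j - 1"] j by auto
    from mult_right_mono[OF n1(1) this] ele[OF j]
    show "real_of_int (es ! j) / 1000000000 + real (nat n - 1) * w *
        (if j = 0 then 0 else real_of_int (es' ! (j - 1)) / 1000000000) \<le> real_of_int (es' ! j) / 1000000000"
      by (simp only: mult.assoc)
    show "0 \<le> real_of_int (es' ! j) / 1000000000" using nn[OF j] by simp
    show "real_of_int (es ! j) / 1000000000 + real (nat n) * w *
        (if j = 0 then 0 else real_of_int (es' ! (j - 1)) / 1000000000) \<le> real_of_int (es' ! j) / 1000000000"
      using ele[OF j] n1(2) by simp
  next
    have "0 \<le> w * (H' / 1000000000 + real_of_int (es' ! (16 - 1)) / 1000000000)"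
      using w0 H'0 nn[of 15] by simp
    from mult_right_mono[OF n1(1) this] Hle'
    show "H / 1000000000 + real (nat n - 1) * w * (H' / 1000000000 + real_of_int (es' ! (16 - 1)) / 1000000000)
        \<le> H' / 1000000000" by (simp only: mult.assoc)
    show "H / 1000000000 + real (nat n) * w * (H' / 1000000000 + real_of_int (es' ! (16 - 1)) / 1000000000)
        \<le> H' / 1000000000" using Hle' n1(2) by simp
    have "0 \<le> 7 * w * (T' / 1000000000)" using w0 T'0 by simp
    from mult_right_mono[OF n1(1) this] Tle'
    show "T / 1000000000 + real (nat n - 1) * (7 * w * (T' / 1000000000)) \<le> T' / 1000000000" by linarith
    show "T / 1000000000 + real (nat n) * (7 * w * (T' / 1000000000)) \<le> T' / 1000000000"
      using Tle' n1(2) by simp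
    show "\<kappa> / 1000000000 + real (nat n) * (w * (\<beta> / 1000000000)) \<le> real_of_int (\<kappa> + n * \<beta> div d + 1) / 1000000000"
      using scaled_step[OF d(1), of \<kappa> "n * \<beta>"] n1(2) by (simp add: w_def)
  qed (use H'0 T'0 \<beta>0 A in auto)
  then show ?thesis using len nns H'0 T'0 by (simp add: ledger_ok_def l')
qed

text \<open>Dropping primes lowers both the coverage and the weights. Thus it is enough that the
  list of single steps contains all odd primes below 183.\<close>

lemma profile_subset:
  assumes "profile \<F> c P L \<kappa> e H T" "Q \<subseteq> P"
  shows "profile \<F> c Q L \<kappa> e H T"
proof -
  obtain E g where E: "finite P" "expectation E" "dominated E P g" "E (\<lambda>x. of_bool (covered \<F> c P x)) \<le> \<kappa>"
    "\<And>j. j < L \<Longrightarrow> weight g P (\<lambda>u. of_bool (u = j)) \<le> e j"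
    "weight g P (\<lambda>u. of_bool (L \<le> u)) \<le> H" "weight g P (\<lambda>u. 7 ^ u) \<le> T"
    using assms(1) unfolding profile_def by blast
  interpret expectation E by fact
  have sub: "weight g Q \<phi> \<le> weight g P \<phi>" if "\<And>u. 0 \<le> \<phi> u" for \<phi>
    unfolding weight_def using E(1) assms(2) that dominated_nonneg[OF E(2,3)]
    by (intro sum_mono2 mult_nonneg_nonneg) auto
  have "E (\<lambda>x. of_bool (covered \<F> c Q x)) \<le> E (\<lambda>x. of_bool (covered \<F> c P x))"
    using assms(2) by (intro mono) (auto simp: covered_def)
  moreover have "dominated E Q g" using E(3) assms(2) unfolding dominated_def by blast
  ultimately show ?thesis unfolding profile_def
    using E assms(2) finite_subset order_trans[OF sub]
    by (intro conjI exI[of _ E] exI[of _ g]) auto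
qed

definition primes_from :: "int \<Rightarrow> int \<Rightarrow> nat set" where
  "primes_from x y = {p. prime p \<and> x \<le> int p \<and> int p < y}"

lemma finite_primes_from: "finite (primes_from x y)"
  by (rule finite_subset[of _ "{..<nat y}"]) (auto simp: primes_from_def)

lemma odd_primes_below_Un:
  assumes "2 < x" "x \<le> y"
  shows "odd_primes_below (nat x) \<union> primes_from x y = odd_primes_below (nat y)"
  using assms by (auto simp: odd_primes_below_def primes_from_def)

lemma blocks_sound:
  assumes "blocks f x S k cs (Some l) = Some (x', l')" "ledger_ok \<F> c (odd_primes_below (nat x)) l"
    "sieve_ok x S" "odd x" "20 \<le> x" "check_table k 2 cs" "length cs \<le> 16"
  shows "ledger_ok \<F> c (odd_primes_below (nat x')) l'"
  using assms
proof (induction f arbitrary: x S l)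
  case (Suc f)
  let ?L = "x div 50"
  obtain n S' where w: "walk (nat ?L) S 0 = (n, S')" by (cases "walk (nat ?L) S 0") auto
  obtain l2 where b: "block x n k cs l = Some l2" and rest: "blocks f (x + 2 * ?L) S' k cs (Some l2) = Some (x', l')"
    using Suc.prems(1) by (cases "block x n k cs l") (auto simp: Let_def w)
  have L: "0 \<le> ?L" "int (nat ?L) = ?L" using Suc.prems(5) by auto
  from walk_sound[OF w Suc.prems(3,4)] Suc.prems(5) L
  have S': "sieve_ok (x + 2 * ?L) S'" and cd: "int (card (primes_from x (x + 2 * ?L))) \<le> n"
    by (auto simp: primes_from_def)
  have "ledger_ok \<F> c (odd_primes_below (nat x) \<union> primes_from x (x + 2 * ?L)) l2"
  proof (rule block_sound[OF Suc.prems(2) b Suc.prems(5) _ Suc.prems(6,7)])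
    show "0 \<le> n" using cd by linarith
    show "card (primes_from x (x + 2 * ?L)) \<le> nat n" using cd by linarith
  qed (auto simp: primes_from_def odd_primes_below_def finite_primes_from[unfolded primes_from_def])
  then have "ledger_ok \<F> c (odd_primes_below (nat (x + 2 * ?L))) l2"
    using odd_primes_below_Un[of x "x + 2 * ?L"] L(1) Suc.prems(5) by simp
  from Suc.IH[OF rest this S'] Suc.prems L show ?case by simp
qed simp

lemma cubic_blocks_sound:
  assumes "cubic_blocks f x S (Some (\<kappa>, T)) = Some (x', \<kappa>', T')"
    "cubic_profile \<F> c (odd_primes_below (nat x)) (\<kappa> / 1000000000) (T / 1000000000)"
    "sieve_ok x S" "odd x" "20 \<le> x"
  shows "cubic_profile \<F> c (odd_primes_below (nat x')) (\<kappa>' / 1000000000) (T' / 1000000000)"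
  using assms
proof (induction f arbitrary: x S \<kappa> T)
  case (Suc f)
  define L t d where "L = x div 100" and "t = x div 4" and "d = x - t"
  obtain n S' where w: "walk (nat L) S 0 = (n, S')" by (cases "walk (nat L) S 0") auto
  define T2 where "T2 = T * d div (d - 7 * n) + 1"
  define \<kappa>2 where "\<kappa>2 = \<kappa> + n * (4 * T2 div (27 * t * t) + 1) div d + 1"
  have nd: "7 * n < d" and rest: "cubic_blocks f (x + 2 * L) S' (Some (\<kappa>2, T2)) = Some (x', \<kappa>', T')"
    using Suc.prems(1) by (auto simp: Let_def w L_def[symmetric] t_def[symmetric] d_def[symmetric] T2_def \<kappa>2_def split: if_splits)
  have L: "0 \<le> L" "int (nat L) = L" using Suc.prems(5) by (auto simp: L_def)
  from walk_sound[OF w Suc.prems(3,4)] Suc.prems(5) L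
  have S': "sieve_ok (x + 2 * L) S'" and cd: "int (card (primes_from x (x + 2 * L))) \<le> n"
    by (auto simp: primes_from_def)
  have n0: "0 \<le> n" using cd by linarith
  have t: "0 < t" "t < x" using Suc.prems(5) by (auto simp: t_def)
  have d: "0 < d" using t by (simp add: d_def)
  have dd: "real (nat x) - real (nat t) = d" using t by (simp add: d_def)
  have T0: "0 \<le> T / (1000000000::real)" using Suc.prems(2) by (rule cubic_profile_nonneg)
  have pow: "T / 1000000000 * (1 + 7 / (real (nat x) - real (nat t))) ^ nat n \<le> T2 / 1000000000"
  proof -
    have u: "real (nat n) * (7 / real_of_int d) < 1" using nd d n0 by simp
    have "(1 + 7 / real_of_int d) ^ nat n \<le> 1 / (1 - real (nat n) * (7 / real_of_int d))"
      by (rule power_le_inverse[OF _ u]) (use d in simp)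
    also have "\<dots> = d / real_of_int (d - 7 * n)" using d n0 nd by (simp add: field_simps)
    finally have "T / 1000000000 * (1 + 7 / real_of_int d) ^ nat n \<le> T / 1000000000 * (d / real_of_int (d - 7 * n))"
      using T0 by (rule mult_left_mono)
    also have "\<dots> = T * d / real_of_int (d - 7 * n) / 1000000000" by simp
    also have "\<dots> \<le> T2 / 1000000000"
      using divide_le_div_plus_one[of "d - 7 * n" "T * d"] nd by (intro divide_right_mono) (auto simp: T2_def)
    finally show ?thesis by (simp only: dd)
  qed
  have "cubic_profile \<F> c (odd_primes_below (nat x) \<union> primes_from x (x + 2 * L))
      (\<kappa> / 1000000000 + real (nat n) * (4 * (T2 / 1000000000) / (27 * (real (nat t))\<^sup>2 * (real (nat x) - real (nat t)))))
      (T2 / 1000000000)"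
  proof (rule cubic_block[OF Suc.prems(2) _ _ pow])
    show "card (primes_from x (x + 2 * L)) \<le> nat n" using cd by linarith
  qed (use t in \<open>auto simp: primes_from_def odd_primes_below_def finite_primes_from[unfolded primes_from_def]\<close>)
  moreover have "\<kappa> / 1000000000 + real (nat n) * (4 * (T2 / 1000000000) / (27 * (real (nat t))\<^sup>2 * (real (nat x) - real (nat t))))
      \<le> \<kappa>2 / 1000000000"
  proof -
    have "4 * T2 / real_of_int (27 * t * t) \<le> real_of_int (4 * T2 div (27 * t * t) + 1)"
      using divide_le_div_plus_one[of "27 * t * t" "4 * T2"] t by simp
    then have "n * (4 * T2 / real_of_int (27 * t * t)) \<le> real_of_int (n * (4 * T2 div (27 * t * t) + 1))"
      unfolding of_int_mult[of n] using n0 by (intro mult_left_mono) auto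
    then have "n * (4 * T2 / real_of_int (27 * t * t)) / d \<le> real_of_int (n * (4 * T2 div (27 * t * t) + 1)) / d"
      using d by (intro divide_right_mono) auto
    also have "\<dots> \<le> real_of_int (n * (4 * T2 div (27 * t * t) + 1) div d + 1)"
      by (rule divide_le_div_plus_one[OF d])
    finally have "(\<kappa> + n * (4 * T2 / real_of_int (27 * t * t)) / d) / 1000000000 \<le> \<kappa>2 / 1000000000"
      unfolding \<kappa>2_def by (intro divide_right_mono) auto
    moreover have "real (nat n) * (4 * (T2 / 1000000000) / (27 * (real (nat t))\<^sup>2 * (real (nat x) - real (nat t))))
       = n * (4 * T2 / real_of_int (27 * t * t)) / d / 1000000000"
      unfolding dd using n0 t by (simp add: power2_eq_square mult_ac)
    ultimately show ?thesis by (simp add: add_divide_distrib)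
  qed
  ultimately have "cubic_profile \<F> c (odd_primes_below (nat (x + 2 * L))) (\<kappa>2 / 1000000000) (T2 / 1000000000)"
    using odd_primes_below_Un[of x "x + 2 * L"] L(1) Suc.prems(5) by (auto intro: cubic_profile_mono)
  from Suc.IH[OF rest this S'] Suc.prems L show ?case by simp
qed simp

section \<open>The small primes\<close>

text \<open>In the names of the tables the first number is the truncation size and the second the
  order of the moment.\<close>

definition table_1_2 :: "int list" where
  "table_1_2 = [0, 0, 1]"

definition table_2_2 :: "int list" where
  "table_2_2 = [0, 0, 3, 6, 3]"

definition table_2_3 :: "int list" where
  "table_2_3 = [0, 0, 1, 17, 46, 45, 15]"

definition table_3_3 :: "int list" where
  "table_3_3 = [0, 0, 1, 32, 230, 820, 1635, 1855, 1120, 280]"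

definition table_4_3 :: "int list" where
  "table_4_3 = [0, 0, 1, 32, 321, 2125, 9500, 28595, 57470, 75565, 62125, 28875, 5775]"

definition table_5_3 :: "int list" where
  "table_5_3 = [0, 0, 1, 32, 321, 2560, 16990, 88753, 349622, 1010674, 2102065, 3081001, 3086391, 2003001,
    756756, 126126]"

text \<open>Columns: the prime, the threshold, the truncation size, the order of the moment minus one, and its
  \<open>union_counts\<close>. The thresholds were found by a numerical search.\<close>

definition singles :: "(int \<times> int \<times> nat \<times> nat \<times> int list) list" where
  "singles = [(3, 1, 0, 0, [0]),
    (5, 2, 1, 1, table_1_2),
    (7, 2, 1, 1, table_1_2),
    (11, 2, 1, 1, table_1_2),
    (13, 3, 2, 1, table_2_2),
    (17, 4, 2, 1, table_2_2),
    (19, 4, 2, 1, table_2_2),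
    (23, 7, 2, 2, table_2_3),
    (29, 7, 2, 2, table_2_3),
    (31, 7, 2, 2, table_2_3),
    (37, 9, 2, 2, table_2_3),
    (41, 9, 2, 2, table_2_3),
    (43, 9, 2, 2, table_2_3),
    (47, 13, 3, 2, table_3_3),
    (53, 13, 3, 2, table_3_3),
    (59, 14, 3, 2, table_3_3),
    (61, 15, 3, 2, table_3_3),
    (67, 16, 3, 2, table_3_3),
    (71, 17, 3, 2, table_3_3),
    (73, 18, 3, 2, table_3_3),
    (79, 19, 3, 2, table_3_3),
    (83, 20, 3, 2, table_3_3),
    (89, 22, 3, 2, table_3_3),
    (97, 24, 3, 2, table_3_3),
    (101, 25, 3, 2, table_3_3),
    (103, 25, 3, 2, table_3_3),
    (107, 26, 3, 2, table_3_3),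
    (109, 27, 3, 2, table_3_3),
    (113, 28, 3, 2, table_3_3),
    (127, 31, 4, 2, table_4_3),
    (131, 32, 4, 2, table_4_3),
    (137, 34, 4, 2, table_4_3),
    (139, 34, 4, 2, table_4_3),
    (149, 37, 4, 2, table_4_3),
    (151, 37, 4, 2, table_4_3),
    (157, 39, 4, 2, table_4_3),
    (163, 40, 4, 2, table_4_3),
    (167, 41, 4, 2, table_4_3),
    (173, 43, 4, 2, table_4_3),
    (179, 44, 4, 2, table_4_3),
    (181, 45, 4, 2, table_4_3)]"

definition sieve_primes :: "int list" where
  "sieve_primes = [3, 5, 7, 11, 13, 17, 19, 23, 29, 31, 37, 41, 43, 47, 53, 59, 61, 67, 71, 73, 79, 83, 89, 97,
    101, 103, 107, 109, 113, 127, 131, 137, 139, 149, 151, 157, 163, 167, 173, 179, 181]"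

section \<open>Evaluating the ledgers up to 32925\<close>

definition initial_ledger :: ledger where
  "initial_ledger = (0, 1000000000 # replicate 15 0, 0, 1000000000)"

definition ledger_1 :: ledger where
  "ledger_1 = (649726764, [1000000000, 2016604918, 1807949276, 970209051, 353797219, 94236067, 19217312, 3101614,
      406080, 43975, 4024, 344, 57, 41, 41, 41],
      41, 13983887347907)"

lemma singles_eval: "fold single singles initial_ledger = ledger_1"
  by code_simp

definition ledger_2 :: ledger where
  "ledger_2 = (720144537, [1000000000, 2198998737, 2193391642, 1336712967, 565109559, 178170819, 43928875, 8760669,
      1449578, 203044, 24504, 2622, 296, 81, 65, 65],
      77, 52784800147470)"

lemma blocks_eval_1:
  "blocks 23 183 (sieve_from 183 sieve_primes) 4 table_4_3 (Some ledger_1) = Some (411, ledger_2)"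
  by code_simp

definition ledger_3 :: ledger where
  "ledger_3 = (763993970, [1000000000, 2361177253, 2563844394, 1723653146, 814063550, 290189056, 81824517, 18868178,
      3648256, 603217, 86689, 11022, 1311, 208, 95, 86],
      114, 169996335802923)"

lemma blocks_eval_2:
  "blocks 21 411 (sieve_from 411 sieve_primes) 5 table_5_3 (Some ledger_2) = Some (903, ledger_3)"
  by code_simp

definition ledger_4 :: ledger where
  "ledger_4 = (796734379, [1000000000, 2511284941, 2930107620, 2137095942, 1104700480, 434519574, 136214403, 35166067,
      7662587, 1436498, 235339, 34184, 4520, 626, 165, 114],
      160, 500372864972652)"

lemma blocks_eval_3:
  "blocks 21 903 (sieve_from 903 sieve_primes) 5 table_5_3 (Some ledger_3) = Some (2025, ledger_4)"
  by code_simp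

text \<open>From 2025 on only the cubic bound is followed. The computation is cut into four
  evaluations and ends just above \<open>2 ^ 15\<close>, where the dyadic estimate takes
  over.\<close>

lemma cubic_blocks_eval_1:
  "cubic_blocks 81 2025 (sieve_from 2025 sieve_primes) (Some (796734379, 500372864972652)) =
    Some (9877, 839653432, 3001029165583003)"
  by code_simp

lemma cubic_blocks_eval_2:
  "cubic_blocks 29 9877 (sieve_from 9877 sieve_primes) (Some (839653432, 3001029165583003)) =
    Some (17497, 844246454, 5296810798642367)"
  by code_simp

lemma cubic_blocks_eval_3:
  "cubic_blocks 19 17497 (sieve_from 17497 sieve_primes) (Some (844246454, 5296810798642367)) =
    Some (25463, 846006491, 7562190487551078)"
  by code_simp

lemma cubic_blocks_eval_4:
  "cubic_blocks 13 25463 (sieve_from 25463 sieve_primes) (Some (846006491, 7562190487551078)) =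
    Some (32925, 846838754, 9578135110599411)"
  by code_simp

lemma initial_ledger_ok:
  assumes "{} \<notin> \<F>"
  shows "ledger_ok \<F> c {} initial_ledger"
proof -
  \<comment> \<open>No prime has been treated yet, so any point evaluation serves;
    \<open>{} \<notin> \<F>\<close> makes the covered mass zero.\<close>
  have E: "expectation (\<lambda>f. f (\<lambda>_. 0))" by unfold_locales auto
  have w: "weight (\<lambda>_. 1) {} \<phi> = \<phi> 0" for \<phi> by (simp add: weight_def)
  have "profile \<F> c {} 16 0 (\<lambda>j. real_of_int ((1000000000 # replicate 15 0) ! j) / 1000000000) 0 1"
    unfolding profile_def
  proof (intro conjI exI[of _ "\<lambda>f. f (\<lambda>_. 0)"] exI[of _ "\<lambda>_. 1"] E)
    show "\<forall>j<16. weight (\<lambda>_. 1) {} (\<lambda>u. of_bool (u = j))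
        \<le> real_of_int ((1000000000 # replicate 15 0) ! j) / 1000000000"
      by (auto simp: w nth_Cons')
  qed (use assms in \<open>auto simp: w dominated_def covered_def\<close>)
  then show ?thesis by (simp add: ledger_ok_def initial_ledger_def)
qed

lemma tables_ok:
  "check_table 0 0 [0]" "check_table 1 1 table_1_2" "check_table 2 1 table_2_2"
  "check_table 2 2 table_2_3" "check_table 3 2 table_3_3" "check_table 4 2 table_4_3" "check_table 5 2 table_5_3"
  by code_simp+

lemma tables_length:
  "length table_1_2 \<le> 16" "length table_2_2 \<le> 16" "length table_2_3 \<le> 16" "length table_3_3 \<le> 16"
  "length table_4_3 \<le> 16" "length table_5_3 \<le> 16"
  by (simp_all add: table_1_2_def table_2_2_def table_2_3_def table_3_3_def table_4_3_def table_5_3_def)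

lemma singles_valid:
  "\<forall>(p, t, k, r, cs)\<in>set singles. 0 < t \<and> t < p \<and> check_table k r cs \<and> length cs \<le> 16 \<and> mode_ok r t"
  using tables_ok tables_length by (simp add: singles_def mode_ok_def)

lemma singles_distinct: "distinct (map (nat \<circ> fst) singles)"
  by (simp add: singles_def)

text \<open>Trial division by the primes up to 13 suffices, since a composite number below 183 is
  below \<open>17 ^ 2\<close>.\<close>

lemma singles_complete:
  "list_all (\<lambda>m. m \<in> set (map fst singles) \<or> list_ex (\<lambda>q. m mod q = 0 \<and> q < m) [2, 3, 5, 7, 11, 13]) [3..182]"
  by code_simp

lemma odd_primes_below_183: "odd_primes_below 183 \<subseteq> set (map (nat \<circ> fst) singles)"
proof
  fix p assume "p \<in> odd_primes_below 183"
  then have p: "prime p" "2 < p" "p < 183" by (simp_all add: odd_primes_below_def)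
  then have "int p \<in> set [3..182]" by (simp only: set_upto atLeastAtMost_iff) simp
  then have "int p \<in> set (map fst singles) \<or>
      list_ex (\<lambda>q. int p mod q = 0 \<and> q < int p) [2, 3, 5, 7, 11, 13]"
    by (rule bspec[OF singles_complete[unfolded list_all_iff]])
  moreover have "\<not> list_ex (\<lambda>q. int p mod q = 0 \<and> q < int p) [2, 3, 5, 7, 11, 13]"
  proof
    assume "list_ex (\<lambda>q. int p mod q = 0 \<and> q < int p) [2, 3, 5, 7, 11, 13]"
    then obtain q where "q \<in> set [2, 3, 5, 7, 11, 13]" and q: "int p mod q = 0" "q < int p"
      unfolding list_ex_iff by (elim bexE conjE)
    then have q1: "1 < q" by auto
    with q have "nat q dvd p" by (simp add: nat_dvd_iff mod_eq_0_iff_dvd)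
    then have "nat q = 1 \<or> nat q = p" using p(1) by (simp add: prime_nat_iff)
    with q q1 show False by auto
  qed
  ultimately have "int p \<in> set (map fst singles)" by (simp only: simp_thms)
  then have "nat (int p) \<in> nat ` set (map fst singles)" by (rule imageI)
  then show "p \<in> set (map (nat \<circ> fst) singles)" by (simp only: nat_int set_map image_comp)
qed

lemma sieve_start: "odd x \<Longrightarrow> 183 \<le> x \<Longrightarrow> sieve_ok x (sieve_from x sieve_primes)"
  by (rule sieve_from_ok) (auto simp: sieve_primes_def)

lemma ledger_ok_subset: "ledger_ok \<F> c P l \<Longrightarrow> Q \<subseteq> P \<Longrightarrow> ledger_ok \<F> c Q l"
  by (cases l) (auto simp: ledger_ok_def intro: profile_subset)

lemma ledger_ok_cubic:
  "ledger_ok \<F> c P (\<kappa>, es, H, T) \<Longrightarrow> cubic_profile \<F> c P (\<kappa> / 1000000000) (T / 1000000000)"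
  by (auto simp: ledger_ok_def intro: profile_cubic)

lemma cubic_profile_32925:
  assumes "{} \<notin> \<F>"
  shows "cubic_profile \<F> c (odd_primes_below 32925) (846838754 / 1000000000) (9578135110599411 / 1000000000)"
proof -
  have "ledger_ok \<F> c ({} \<union> set (map (nat \<circ> fst) singles)) (fold single singles initial_ledger)"
    by (rule fold_single_sound[OF initial_ledger_ok[OF assms] singles_distinct _ singles_valid]) simp
  then have "ledger_ok \<F> c ({} \<union> set (map (nat \<circ> fst) singles)) ledger_1"
    by (simp only: singles_eval)
  then have "ledger_ok \<F> c (odd_primes_below 183) ledger_1"
    by (rule ledger_ok_subset) (use odd_primes_below_183 in blast)
  then have "ledger_ok \<F> c (odd_primes_below (nat 183)) ledger_1" by simp
  then have "ledger_ok \<F> c (odd_primes_below (nat 411)) ledger_2"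
    by (rule blocks_sound[OF blocks_eval_1 _ sieve_start _ _ tables_ok(6) tables_length(5)]) simp_all
  then have "ledger_ok \<F> c (odd_primes_below (nat 903)) ledger_3"
    by (rule blocks_sound[OF blocks_eval_2 _ sieve_start _ _ tables_ok(7) tables_length(6)]) simp_all
  then have "ledger_ok \<F> c (odd_primes_below (nat 2025)) ledger_4"
    by (rule blocks_sound[OF blocks_eval_3 _ sieve_start _ _ tables_ok(7) tables_length(6)]) simp_all
  from ledger_ok_cubic[OF this[unfolded ledger_4_def]]
  have "cubic_profile \<F> c (odd_primes_below (nat 9877))
      (real_of_int 839653432 / 1000000000) (real_of_int 3001029165583003 / 1000000000)"
    by (rule cubic_blocks_sound[OF cubic_blocks_eval_1 _ sieve_start]) simp_all
  then have "cubic_profile \<F> c (odd_primes_below (nat 17497))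
      (real_of_int 844246454 / 1000000000) (real_of_int 5296810798642367 / 1000000000)"
    by (rule cubic_blocks_sound[OF cubic_blocks_eval_2 _ sieve_start]) simp_all
  then have "cubic_profile \<F> c (odd_primes_below (nat 25463))
      (real_of_int 846006491 / 1000000000) (real_of_int 7562190487551078 / 1000000000)"
    by (rule cubic_blocks_sound[OF cubic_blocks_eval_3 _ sieve_start]) simp_all
  then have "cubic_profile \<F> c (odd_primes_below (nat 32925))
      (real_of_int 846838754 / 1000000000) (real_of_int 9578135110599411 / 1000000000)"
    by (rule cubic_blocks_sound[OF cubic_blocks_eval_4 _ sieve_start]) simp_all
  then show ?thesis by simp
qed

text \<open>If every point were covered, the covered mass would be 1, against its bound below
  1.\<close>

lemma uncovered_point:
  assumes F: "{} \<notin> \<F>" "\<And>F q. F \<in> \<F> \<Longrightarrow> q \<in> F \<Longrightarrow> prime q \<and> 2 < q \<and> q < N"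
  shows "\<exists>x. \<forall>F\<in>\<F>. \<not> agree F (c F) x"
proof -
  \<comment> \<open>The exponent \<open>15 + N\<close> takes the dyadic tail past \<open>N\<close>,
    so that \<open>P\<close> contains every prime that occurs.\<close>
  define P where "P = odd_primes_below (max 32925 (2 ^ (15 + N)))"
  \<comment> \<open>The numerical condition holds with room to spare:
    \<open>0.84684 + 9578136 / 80000000\<close> is about \<open>0.967\<close>.\<close>
  have "\<exists>\<kappa>'<1. \<exists>T'. cubic_profile \<F> c P \<kappa>' T'"
    unfolding P_def by (rule cubic_tail[OF cubic_profile_32925[OF F(1)]]) simp_all
  then obtain \<kappa> T where "\<kappa> < 1" and prof: "cubic_profile \<F> c P \<kappa> T" by blast
  obtain E where E: "expectation E" "E (\<lambda>x. of_bool (covered \<F> c P x)) \<le> \<kappa>"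
    using prof unfolding cubic_profile_def by blast
  interpret expectation E by fact
  have "\<exists>x. \<not> covered \<F> c P x"
  proof (rule ccontr)
    assume "\<not> (\<exists>x. \<not> covered \<F> c P x)"
    then have "E (\<lambda>x. of_bool (covered \<F> c P x)) = 1" using one by simp
    with E(2) \<open>\<kappa> < 1\<close> show False by simp
  qed
  moreover have "F \<subseteq> P" if "F \<in> \<F>" for F
  proof
    fix q assume "q \<in> F"
    with F(2)[OF that] have "prime q" "2 < q" "q < N" by auto
    moreover have "N < 2 ^ (15 + N)" by (rule less_le_trans[OF less_exp]) (simp add: power_increasing)
    ultimately show "q \<in> P" by (auto simp: P_def odd_primes_below_def less_max_iff_disj)
  qed
  ultimately show ?thesis by (auto simp: covered_def)
qed

section \<open>From covering systems to prescribed residues\<close>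

theorem theorem1p1:
  fixes n :: nat and a d :: "nat \<Rightarrow> int"
  assumes mod_gt1: "\<And>i. i < n \<Longrightarrow> d i > 1"
    and distinct: "inj_on d {..<n}"
    and sqfree: "\<And>i. i < n \<Longrightarrow> squarefree (d i)"
    and covers: "\<And>x::int. \<exists>i<n. [x = a i] (mod d i)"
  shows "\<exists>i<n. even (d i)"
proof (rule ccontr)
  assume "\<not> (\<exists>i<n. even (d i))"
  then have odd: "\<And>i. i < n \<Longrightarrow> odd (d i)" by blast
  have nat_d: "int (nat (d i)) = d i" if "i < n" for i using mod_gt1[OF that] by simp
  \<comment> \<open>A square-free modulus is the product of its prime factors, so \<open>F i\<close>
    determines \<open>d i\<close> and hence, the moduli being distinct, the index
    \<open>i\<close>.\<close>
  define F where "F i = prime_factors (nat (d i))" for i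
  have prod: "int (\<Prod>(F i)) = d i" if "i < n" for i
  proof -
    have "squarefree (nat (d i))"
      unfolding squarefree_def
    proof (intro allI impI)
      fix x assume "x\<^sup>2 dvd nat (d i)"
      then have "int (x\<^sup>2) dvd int (nat (d i))" by (simp only: of_nat_dvd_iff)
      then have "(int x)\<^sup>2 dvd d i" using nat_d[OF that] by simp
      then have "is_unit (int x)" using sqfree[OF that] unfolding squarefree_def by blast
      then show "is_unit x" by simp
    qed
    then have "\<Prod>(F i) = nat (d i)"
    proof -
      have nz: "nat (d i) \<noteq> 0" using mod_gt1[OF that] by simp
      have "\<Prod>(F i) = (\<Prod>p\<in>F i. p ^ multiplicity p (nat (d i)))"
        using \<open>squarefree (nat (d i))\<close> squarefree_factorial_semiring'[OF nz]
        by (intro prod.cong) (auto simp: F_def)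
      also have "\<dots> = nat (d i)" unfolding F_def using prod_prime_factors[OF nz] by simp
      finally show ?thesis .
    qed
    then show ?thesis using mod_gt1[OF that] by simp
  qed
  have inj: "i = j" if "i < n" "j < n" "F i = F j" for i j
  proof -
    have "d i = d j" using prod[OF that(1)] prod[OF that(2)] that(3) by simp
    with distinct that show ?thesis by (simp add: inj_on_def)
  qed
  have dvd: "int q dvd d i" "prime q" "2 < q" if "i < n" "q \<in> F i" for i q
  proof -
    have q: "prime q" "q dvd nat (d i)" using that by (auto simp: F_def)
    then have "int q dvd int (nat (d i))" by (simp only: of_nat_dvd_iff)
    then show *: "int q dvd d i" using nat_d[OF that(1)] by simp
    show "prime q" by fact
    have "q \<noteq> 2" using * odd[OF that(1)] by auto
    then show "2 < q" using prime_ge_2_nat[OF q(1)] by simp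
  qed
  define \<F> where "\<F> = F ` {..<n}"
  \<comment> \<open>Residues are indexed by prime sets instead of progressions; injectivity of
    \<open>F\<close> on the indices below \<open>n\<close> makes the \<open>THE\<close>
    meaningful.\<close>
  define c where "c G q = nat (a (THE i. i < n \<and> F i = G) mod int q)" for G q
  have c: "c (F i) q = nat (a i mod int q)" if "i < n" for i q
  proof -
    have "(THE j. j < n \<and> F j = F i) = i"
    proof (rule the_equality)
      show "j = i" if "j < n \<and> F j = F i" for j using inj[of j i] that \<open>i < n\<close> by blast
    qed (simp add: that)
    then show ?thesis by (simp add: c_def)
  qed
  have finF: "finite (\<Union>\<F>)" by (auto simp: \<F>_def F_def)
  have "{} \<notin> \<F>"
  proof
    assume "{} \<in> \<F>"
    then obtain i where "i < n" "F i = {}" by (auto simp: \<F>_def)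
    with prod[of i] mod_gt1[of i] show False by simp
  qed
  moreover obtain N where "\<And>q. q \<in> \<Union>\<F> \<Longrightarrow> q < N"
    using finF unfolding finite_nat_set_iff_bounded by blast
  then have "prime q \<and> 2 < q \<and> q < N" if "G \<in> \<F>" "q \<in> G" for G q
    using that dvd(2,3) by (auto simp: \<F>_def)
  ultimately obtain x where x: "\<And>G. G \<in> \<F> \<Longrightarrow> \<not> agree G (c G) x"
    using uncovered_point[where \<F> = \<F> and N = N and c = c] by blast
  \<comment> \<open>The Chinese remainder theorem turns the uncovered point \<open>x\<close> into an
    integer \<open>z\<close>. The progression containing \<open>z\<close> then agrees with
    \<open>x\<close>, a contradiction.\<close>
  have "\<forall>p\<in>\<Union>\<F>. \<forall>q\<in>\<Union>\<F>. p \<noteq> q \<longrightarrow> coprime p q"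
    unfolding \<F>_def by (auto intro: primes_coprime dvd(2))
  then obtain z where z: "\<And>q. q \<in> \<Union>\<F> \<Longrightarrow> [z = x q] (mod q)"
    using chinese_remainder_nat[OF finF, of "\<lambda>q. q" x] by blast
  obtain i where i: "i < n" "[int z = a i] (mod d i)" using covers by blast
  have "agree (F i) (c (F i)) x"
    unfolding agree_def
  proof
    fix q assume q: "q \<in> F i"
    have "[int z = a i] (mod int q)" by (rule cong_dvd_modulus[OF i(2) dvd(1)[OF i(1) q]])
    moreover have "[z = x q] (mod q)" using z q i(1) by (auto simp: \<F>_def)
    ultimately have "int (x q mod q) = a i mod int q"
      unfolding cong_def by (simp only: of_nat_mod[symmetric])
    then show "x q mod q = c (F i) q" unfolding c[OF i(1)] by (metis nat_int)
  qed
  then show False using x i(1) by (auto simp: \<F>_def)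
qed

end
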